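(* Let $H$ be an $n\times n$ Hermitian matrix. If $n\geq 8$ and $4\leq k\leq n-4$, then $H$ is $k$-spectrally monomorphic if and only if $H$ is $\Gamma$-equivalent to $H_n(c)$ for some complex number $c$.
   Context: For an $n\times n$ complex matrix $A$ and $\alpha\subseteq\{1,\ldots,n\}$, $A[\alpha]$ denotes the principal submatrix of $A$ with rows and columns indexed by $\alpha$. The matrix $A$ is $k$-spectrally monomorphic if all its $k\times k$ principal submatrices $A[\alpha]$, $|\alpha|=k$, have the same characteristic polynomial. Let $\Gamma$ be the subgroup of $GL_n(\mathbb{C})$ generated by the unitary diagonal matrices (diagonal matrices whose diagonal entries have modulus $1$) and the permutation matrices. Two $n\times n$ Hermitian matrices $H_1,H_2$ are $\Gamma$-equivalent if $H_2=a(SH_1S^{*})+bI$ for some real numbers $a\neq 0$ and $b$ and some $S\in\Gamma$. This is an equivalence relation. For a complex number $c$, $H_n(c)$ is the $n\times n$ Hermitian matrix with zero diagonal, all entries strictly above the diagonal equal to $c$, and all entries strictly below the diagonal equal to $\overline{c}$. *)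

theory Defs
  imports
    "HOL-Algebra.Generated_Groups"
    "HOL-Combinatorics.Permutations"
    "Jordan_Normal_Form.Char_Poly"
    "Jordan_Normal_Form.DL_Submatrix"
    "Jordan_Normal_Form.Schur_Decomposition"
begin

text \<open>Rows and columns of an \<open>n \<times> n\<close> matrix are indexed by \<open>{0..<n}\<close> instead of \<open>{1..n}\<close>.\<close>

definition hermitian_mat :: "complex mat \<Rightarrow> bool" where
  "hermitian_mat A \<longleftrightarrow> square_mat A \<and> mat_adjoint A = A"

definition principal_submatrix :: "'a mat \<Rightarrow> nat set \<Rightarrow> 'a mat" where
  "principal_submatrix A \<alpha> = submatrix A \<alpha> \<alpha>"

definition spectrally_monomorphic :: "nat \<Rightarrow> complex mat \<Rightarrow> bool" where
  "spectrally_monomorphic k A \<longleftrightarrow>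
    (\<forall>\<alpha> \<beta>. \<alpha> \<subseteq> {0..<dim_row A} \<and> card \<alpha> = k \<and> \<beta> \<subseteq> {0..<dim_row A} \<and> card \<beta> = k \<longrightarrow>
      char_poly (principal_submatrix A \<alpha>) = char_poly (principal_submatrix A \<beta>))"

definition GL :: "nat \<Rightarrow> complex mat monoid" where
  "GL n = units_of (ring_mat TYPE(complex) n ())"

definition unitary_diagonal_mats :: "nat \<Rightarrow> complex mat set" where
  "unitary_diagonal_mats n =
    {D \<in> carrier_mat n n. diagonal_mat D \<and> (\<forall>i<n. cmod (D $$ (i,i)) = 1)}"

definition permutation_mat :: "nat \<Rightarrow> (nat \<Rightarrow> nat) \<Rightarrow> complex mat" where
  "permutation_mat n p = mat n n (\<lambda>(i,j). if i = p j then 1 else 0)"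

definition permutation_mats :: "nat \<Rightarrow> complex mat set" where
  "permutation_mats n = {permutation_mat n p | p. p permutes {0..<n}}"

definition Gamma_group :: "nat \<Rightarrow> complex mat set" where
  "Gamma_group n = generate (GL n) (unitary_diagonal_mats n \<union> permutation_mats n)"

text \<open>A relation between Hermitian matrices of the same size \<open>n\<close>.\<close>

definition Gamma_equivalent :: "nat \<Rightarrow> complex mat \<Rightarrow> complex mat \<Rightarrow> bool" where
  "Gamma_equivalent n H1 H2 \<longleftrightarrow>
    H1 \<in> carrier_mat n n \<and> hermitian_mat H1 \<and> H2 \<in> carrier_mat n n \<and> hermitian_mat H2 \<and>
    (\<exists>(a::real) (b::real) S. a \<noteq> 0 \<and> S \<in> Gamma_group n \<and>
      H2 = complex_of_real a \<cdot>\<^sub>m (S * H1 * mat_adjoint S) + complex_of_real b \<cdot>\<^sub>m 1\<^sub>m n)"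

definition Hn :: "nat \<Rightarrow> complex \<Rightarrow> complex mat" where
  "Hn n c = mat n n (\<lambda>(i,j). if i < j then c else if i = j then 0 else cnj c)"

lemma carrier_GL: "carrier (GL n) = Units (ring_mat TYPE(complex) n ())"
  unfolding GL_def by (simp add: units_of_carrier)

lemma group_GL: "group (GL n)"
proof -
  interpret semiring "ring_mat TYPE(complex) n ()" by (rule semiring_mat)
  show ?thesis unfolding GL_def by (rule units_group)
qed

lemma carrier_GL_I:
  assumes "A \<in> carrier_mat n n" "B \<in> carrier_mat n n" "A * B = 1\<^sub>m n" "B * A = 1\<^sub>m n"
  shows "A \<in> carrier (GL n)"
  unfolding carrier_GL Units_def ring_mat_simps using assms by blast

lemma unitary_diagonal_mats_GL: "unitary_diagonal_mats n \<subseteq> carrier (GL n)"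
proof
  fix D assume "D \<in> unitary_diagonal_mats n"
  hence D: "D \<in> carrier_mat n n"
    and off: "\<And>i j. i < n \<Longrightarrow> j < n \<Longrightarrow> i \<noteq> j \<Longrightarrow> D $$ (i,j) = 0"
    and u: "\<And>i. i < n \<Longrightarrow> D $$ (i,i) \<noteq> 0"
    unfolding unitary_diagonal_mats_def diagonal_mat_def by fastforce+
  define B where "B = mat n n (\<lambda>(i,j). if i = j then inverse (D $$ (i,i)) else 0)"
  have sum1: "(\<Sum>l\<in>{0..<n}. f l) = f i" if "i < n" "\<And>l. l < n \<Longrightarrow> l \<noteq> i \<Longrightarrow> f l = 0"
    for f :: "nat \<Rightarrow> complex" and i
    using that by (subst sum.remove[of _ i]) (auto intro!: sum.neutral)
  show "D \<in> carrier (GL n)"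
  proof (rule carrier_GL_I[OF D])
    show "B \<in> carrier_mat n n" by (simp add: B_def)
    show "D * B = 1\<^sub>m n"
    proof (rule eq_matI)
      fix i j assume "i < dim_row (1\<^sub>m n)" "j < dim_col (1\<^sub>m n)"
      hence ij: "i < n" "j < n" by auto
      have "(D * B) $$ (i,j) = (\<Sum>l\<in>{0..<n}. D $$ (i,l) * B $$ (l,j))"
        using ij D by (simp add: scalar_prod_def B_def)
      also have "\<dots> = D $$ (i,i) * B $$ (i,j)"
        by (rule sum1) (use ij off in auto)
      finally show "(D * B) $$ (i,j) = 1\<^sub>m n $$ (i,j)" using ij u by (auto simp: B_def)
    qed (use D in \<open>auto simp: B_def\<close>)
    show "B * D = 1\<^sub>m n"
    proof (rule eq_matI)
      fix i j assume "i < dim_row (1\<^sub>m n)" "j < dim_col (1\<^sub>m n)"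
      hence ij: "i < n" "j < n" by auto
      have "(B * D) $$ (i,j) = (\<Sum>l\<in>{0..<n}. B $$ (i,l) * D $$ (l,j))"
        using ij D by (simp add: scalar_prod_def B_def)
      also have "\<dots> = B $$ (i,i) * D $$ (i,j)"
        by (rule sum1) (use ij in \<open>auto simp: B_def\<close>)
      finally show "(B * D) $$ (i,j) = 1\<^sub>m n $$ (i,j)" using ij u off by (auto simp: B_def)
    qed (use D in \<open>auto simp: B_def\<close>)
  qed
qed

lemma permutation_mat_mult:
  assumes "p permutes {0..<n}" "q permutes {0..<n}"
  shows "permutation_mat n p * permutation_mat n q = permutation_mat n (p \<circ> q)"
proof (rule eq_matI)
  fix i j assume "i < dim_row (permutation_mat n (p \<circ> q))" "j < dim_col (permutation_mat n (p \<circ> q))"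
  hence ij: "i < n" "j < n" by (auto simp: permutation_mat_def)
  have qj: "q j \<in> {0..<n}" using permutes_in_image[OF assms(2), of j] ij by simp
  have "(permutation_mat n p * permutation_mat n q) $$ (i,j)
      = (\<Sum>l\<in>{0..<n}. (if i = p l then 1 else 0) * (if l = q j then 1 else 0))"
    using ij by (simp add: scalar_prod_def permutation_mat_def)
  also have "\<dots> = (\<Sum>l\<in>{0..<n}. if l = q j then (if i = p l then 1 else 0) else 0)"
    by (rule sum.cong) auto
  also have "\<dots> = (if i = p (q j) then 1 else 0)"
    using qj by simp
  finally show "(permutation_mat n p * permutation_mat n q) $$ (i,j)
      = permutation_mat n (p \<circ> q) $$ (i,j)"
    using ij by (simp add: permutation_mat_def)
qed (auto simp: permutation_mat_def)

lemma permutation_mats_GL: "permutation_mats n \<subseteq> carrier (GL n)"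
proof
  fix P assume "P \<in> permutation_mats n"
  then obtain p where p: "p permutes {0..<n}" and P: "P = permutation_mat n p"
    by (auto simp: permutation_mats_def)
  have one: "permutation_mat n id = 1\<^sub>m n"
    by (rule eq_matI) (auto simp: permutation_mat_def)
  show "P \<in> carrier (GL n)" unfolding P
  proof (rule carrier_GL_I)
    show "permutation_mat n p * permutation_mat n (inv_into UNIV p) = 1\<^sub>m n"
      using permutation_mat_mult[OF p permutes_inv[OF p]] one permutes_inv_o[OF p] by simp
    show "permutation_mat n (inv_into UNIV p) * permutation_mat n p = 1\<^sub>m n"
      using permutation_mat_mult[OF permutes_inv[OF p] p] one permutes_inv_o[OF p] by simp
  qed (auto simp: permutation_mat_def)
qed

lemma subgroup_Gamma_group: "subgroup (Gamma_group n) (GL n)"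
  unfolding Gamma_group_def
  by (rule group.generate_is_subgroup[OF group_GL])
     (use unitary_diagonal_mats_GL permutation_mats_GL in auto)

end

theory Submission
  imports Defs
begin

text \<open>
  Every principal submatrix of \<open>Hn n c\<close> of size \<open>k\<close> is \<open>Hn k c\<close>, and \<open>\<Gamma>\<close>-equivalence preserves spectral
  monomorphy, because \<open>\<Gamma>\<close> consists of the unitary monomial matrices; this gives one direction.

  For the other, the coefficients of the characteristic polynomial of \<open>H[\<alpha>]\<close> are up to sign the sums of
  the minors \<open>det H[\<beta>]\<close> over \<open>\<beta> \<subseteq> \<alpha>\<close> of a given size \<open>j\<close>. If these sums do not depend on the \<open>k\<close>-set \<open>\<alpha>\<close>
  and \<open>j \<le> k \<le> n - j\<close>, then the minors of order \<open>j\<close> themselves are all equal, since the inclusion matrix of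
  \<open>j\<close>-sets in \<open>k\<close>-sets has full rank (\<open>subset_sums_determine\<close>). The hypothesis on \<open>k\<close> allows
  \<open>j = 1, 2, 3, 4\<close>.

  These four orders pin down \<open>H\<close>. Order one gives a constant diagonal, which may be taken to be zero, and
  order two a constant modulus \<open>r\<close> off the diagonal. If \<open>r > 0\<close>, a diagonal unitary congruence makes row
  \<open>0\<close> equal to \<open>r\<close> off the diagonal. Order three on the triples through \<open>0\<close> fixes the real parts of the other entries, so
  these all lie in \<open>{w, cnj w}\<close> for one number \<open>w\<close> of modulus \<open>r\<close>. If \<open>w\<close> is not real, the
  matrix is a tournament on the nonzero indices, and order four on the quadruples through \<open>0\<close>
  distinguishes its cyclic from its transitive triangles; as four vertices cannot span cyclic triangles
  only, all are transitive (\<open>transitive\<close>). The tournament is therefore a linear order. Listing the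
  indices along it and multiplying row \<open>0\<close> by \<open>w / r\<close> yields \<open>Hn n w\<close> (\<open>exists_ordering\<close>).
\<close>

section \<open>Principal minors as Leibniz sums\<close>

text \<open>
  The determinant of the submatrix on \<open>S\<close>, written over the permutations of \<open>S\<close> itself. Since the
  sum does not depend on how \<open>S\<close> is enumerated, a simultaneous permutation of rows and columns acts
  on minors through \<open>S\<close> alone, and minors of different sizes live in one ambient index set.
\<close>

definition principal_minor :: "('a \<Rightarrow> 'a \<Rightarrow> 'b::comm_ring_1) \<Rightarrow> 'a set \<Rightarrow> 'b" where
  "principal_minor f S = (\<Sum>p | p permutes S. of_int (sign p) * (\<Prod>i\<in>S. f i (p i)))"

lemma principal_minor_cong:
  assumes "\<And>i j. i \<in> S \<Longrightarrow> j \<in> S \<Longrightarrow> f i j = g i j"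
  shows "principal_minor f S = principal_minor g S"
  unfolding principal_minor_def
  by (intro sum.cong arg_cong2[where f = "(*)"] prod.cong refl assms)
     (simp_all add: permutes_in_image)

lemma principal_minor_reindex:
  assumes b: "bij_betw b S T" and S: "finite S"
  shows "principal_minor f T = principal_minor (\<lambda>i j. f (b i) (b j)) S"
proof -
  have inj: "inj_on b S" and T: "b ` S = T" using b by (auto simp: bij_betw_def)
  have b': "bij_betw (inv_into S b) T S" using b by (rule bij_betw_inv_into)
  have summand: "of_int (sign (map_permutation S b p)) * (\<Prod>i\<in>T. f i (map_permutation S b p i))
      = of_int (sign p) * (\<Prod>i\<in>S. f (b i) (b (p i)))" if p: "p permutes S" for p
  proof -
    have "(\<Prod>i\<in>T. f i (map_permutation S b p i)) = (\<Prod>i\<in>S. f (b i) (map_permutation S b p (b i)))"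
      using prod.reindex_bij_betw[OF b, of "\<lambda>i. f i (map_permutation S b p i)"] by simp
    also have "\<dots> = (\<Prod>i\<in>S. f (b i) (b (p i)))"
      by (intro prod.cong refl) (simp add: map_permutation_apply[OF inj])
    finally show ?thesis by (simp add: sign_map_permutation[OF inj p S])
  qed
  have "(\<Sum>p | p permutes S. of_int (sign p) * (\<Prod>i\<in>S. f (b i) (b (p i))))
      = (\<Sum>p | p permutes T. of_int (sign p) * (\<Prod>i\<in>T. f i (p i)))"
  proof (rule sum.reindex_bij_witness[where j = "map_permutation S b"
        and i = "map_permutation T (inv_into S b)"])
    fix p assume "p \<in> {p. p permutes S}"
    then have p: "p permutes S" by simp
    show "map_permutation T (inv_into S b) (map_permutation S b p) = p"
      using map_permutation_compose_inv[OF b p] inj by simp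
    show "map_permutation S b p \<in> {p. p permutes T}"
      using map_permutation_permutes[OF b p] by simp
    show "of_int (sign (map_permutation S b p)) * (\<Prod>i\<in>T. f i (map_permutation S b p i))
      = of_int (sign p) * (\<Prod>i\<in>S. f (b i) (b (p i)))" by (rule summand[OF p])
  next
    fix p assume "p \<in> {p. p permutes T}"
    then have p: "p permutes T" by simp
    show "map_permutation S b (map_permutation T (inv_into S b) p) = p"
      using map_permutation_compose_inv[OF b' p, of b] T by (simp add: f_inv_into_f)
    show "map_permutation T (inv_into S b) p \<in> {p. p permutes S}"
      using map_permutation_permutes[OF b' p] by simp
  qed
  then show ?thesis by (simp add: principal_minor_def)
qed

text \<open>
  Taking \<open>v i = inverse (u i)\<close> shows that a diagonal similarity changes no principal minor. This is
  how unimodular rescalings of a Hermitian matrix are handled below.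
\<close>

lemma principal_minor_scale:
  "principal_minor (\<lambda>i j. u i * v j * f i j) S = prod u S * prod v S * principal_minor f S"
proof -
  have "(\<Prod>i\<in>S. u i * v (p i) * f i (p i)) = prod u S * prod v S * (\<Prod>i\<in>S. f i (p i))"
    if "p permutes S" for p
    using prod.permute[OF that, of v] by (simp add: prod.distrib o_def)
  then show ?thesis
    by (simp add: principal_minor_def sum_distrib_left ac_simps)
qed

lemma principal_minor_empty: "principal_minor f {} = 1"
  by (simp add: principal_minor_def)

text \<open>
  Laplace expansion along row \<open>a\<close>. A permutation of \<open>insert a S\<close> sending \<open>a\<close> to \<open>b\<close> is \<open>q\<close> followed by
  the transposition of \<open>a\<close> and \<open>b\<close>, with \<open>q\<close> a permutation of \<open>S\<close>; the transposition redirects column \<open>b\<close>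
  of the remaining minor to column \<open>a\<close> and accounts for the minus sign.
\<close>

lemma principal_minor_insert:
  assumes S: "finite S" and a: "a \<notin> S"
  shows "principal_minor f (insert a S) = f a a * principal_minor f S
    - (\<Sum>b\<in>S. f a b * principal_minor (\<lambda>i j. f i (if j = b then a else j)) S)"
proof -
  define \<tau> where "\<tau> = Transposition.transpose a"
  have summand: "of_int (sign (\<tau> b \<circ> q)) * (\<Prod>i\<in>insert a S. f i ((\<tau> b \<circ> q) i))
      = of_int (sign (\<tau> b)) * f a b * (of_int (sign q) * (\<Prod>i\<in>S. f i (if q i = b then a else q i)))"
    if q: "q permutes S" for b q
  proof -
    have "q a = a" using a q by (simp add: permutes_not_in)
    moreover have "(\<Prod>i\<in>S. f i (\<tau> b (q i))) = (\<Prod>i\<in>S. f i (if q i = b then a else q i))"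
    proof (rule prod.cong[OF refl])
      fix i assume "i \<in> S"
      then have "q i \<noteq> a" using a permutes_in_image[OF q, of i] by auto
      then show "f i (\<tau> b (q i)) = f i (if q i = b then a else q i)"
        by (simp add: \<tau>_def transpose_def)
    qed
    moreover have "sign (\<tau> b \<circ> q) = sign (\<tau> b) * sign q"
      unfolding \<tau>_def using S q by (intro sign_compose permutation_swap_id permutation_permutes[THEN iffD2]) auto
    ultimately show ?thesis using S a by (simp add: \<tau>_def ac_simps)
  qed
  have "principal_minor f (insert a S) = (\<Sum>b\<in>insert a S. \<Sum>q | q permutes S.
      of_int (sign (\<tau> b)) * f a b * (of_int (sign q) * (\<Prod>i\<in>S. f i (if q i = b then a else q i))))"
    unfolding principal_minor_def sum_over_permutations_insert[OF S a] \<tau>_def[symmetric]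
    by (intro sum.cong refl summand) simp
  also have "\<dots> = (\<Sum>b\<in>insert a S. of_int (sign (\<tau> b)) * f a b * principal_minor (\<lambda>i j. f i (if j = b then a else j)) S)"
    by (simp only: principal_minor_def sum_distrib_left)
  also have "\<dots> = f a a * principal_minor (\<lambda>i j. f i (if j = a then a else j)) S
      - (\<Sum>b\<in>S. f a b * principal_minor (\<lambda>i j. f i (if j = b then a else j)) S)"
  proof -
    have "(\<Sum>b\<in>S. of_int (sign (\<tau> b)) * f a b * principal_minor (\<lambda>i j. f i (if j = b then a else j)) S)
        = (\<Sum>b\<in>S. - (f a b * principal_minor (\<lambda>i j. f i (if j = b then a else j)) S))"
      using a by (intro sum.cong) (auto simp: \<tau>_def sign_swap_id)
    then show ?thesis using S a by (simp add: \<tau>_def sum_negf)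
  qed
  also have "(\<lambda>i j. f i (if j = a then a else j)) = f" by (intro ext) auto
  finally show ?thesis .
qed

lemma principal_minor_1: "principal_minor f {i} = f i i"
  by (simp add: principal_minor_insert principal_minor_empty)

lemma principal_minor_2:
  assumes "i \<noteq> j"
  shows "principal_minor f {i, j} = f i i * f j j - f i j * f j i"
  using assms by (simp add: principal_minor_insert principal_minor_1)

lemma principal_minor_3:
  assumes "distinct [i, j, k]"
  shows "principal_minor f {i, j, k} = f i i * (f j j * f k k - f j k * f k j)
    - (f i j * (f j i * f k k - f j k * f k i) + f i k * (f j j * f k i - f j i * f k j))"
proof -
  have "principal_minor f {i, j, k} = f i i * principal_minor f {j, k}
    - (f i j * principal_minor (\<lambda>x y. f x (if y = j then i else y)) {j, k}
      + f i k * principal_minor (\<lambda>x y. f x (if y = k then i else y)) {j, k})"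
    using assms by (subst principal_minor_insert) auto
  then show ?thesis using assms by (auto simp: principal_minor_2)
qed

text \<open>
  With zero diagonal only the derangements survive: the three products of two transpositions and the
  six four-cycles, the latter grouped below as three cycles with their reversals.
\<close>

lemma principal_minor_4_zero_diagonal:
  assumes "distinct [i, j, k, l]" and "\<And>a. a \<in> {i, j, k, l} \<Longrightarrow> f a a = 0"
  shows "principal_minor f {i, j, k, l} =
     f i j * f j i * (f k l * f l k) + f i k * f k i * (f j l * f l j) + f i l * f l i * (f j k * f k j)
     - (f i j * f j k * f k l * f l i + f i l * f l k * f k j * f j i)
     - (f i k * f k l * f l j * f j i + f i j * f j l * f l k * f k i)
     - (f i l * f l j * f j k * f k i + f i k * f k j * f j l * f l i)"
proof -
  have z: "f i i = 0" "f j j = 0" "f k k = 0" "f l l = 0" using assms(2) by auto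
  have ne: "i \<noteq> j" "j \<noteq> i" "i \<noteq> k" "k \<noteq> i" "j \<noteq> k" "k \<noteq> j"
    "i \<noteq> l" "l \<noteq> i" "j \<noteq> l" "l \<noteq> j" "l \<noteq> k" "k \<noteq> l" using assms(1) by auto
  have "principal_minor f {i, j, k, l} = f i i * principal_minor f {j, k, l}
    - (f i j * principal_minor (\<lambda>x y. f x (if y = j then i else y)) {j, k, l}
      + (f i k * principal_minor (\<lambda>x y. f x (if y = k then i else y)) {j, k, l}
      + f i l * principal_minor (\<lambda>x y. f x (if y = l then i else y)) {j, k, l}))"
    using ne by (subst principal_minor_insert) auto
  then show ?thesis by (simp add: principal_minor_3 ne z algebra_simps)
qed

section \<open>Characteristic polynomials of principal submatrices\<close>

lemma principal_submatrix_reindex: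
  assumes A: "A \<in> carrier_mat n n" and \<alpha>: "\<alpha> \<subseteq> {0..<n}"
  shows "principal_submatrix A \<alpha> \<in> carrier_mat (card \<alpha>) (card \<alpha>)"
    and "bij_betw (pick \<alpha>) {0..<card \<alpha>} \<alpha>"
    and "\<And>i j. i < card \<alpha> \<Longrightarrow> j < card \<alpha> \<Longrightarrow>
      principal_submatrix A \<alpha> $$ (i, j) = A $$ (pick \<alpha> i, pick \<alpha> j)"
proof -
  have eq: "{i. i < n \<and> i \<in> \<alpha>} = \<alpha>" using \<alpha> by auto
  show "principal_submatrix A \<alpha> \<in> carrier_mat (card \<alpha>) (card \<alpha>)"
    by (rule carrier_matI) (simp_all add: principal_submatrix_def dim_submatrix carrier_matD[OF A] eq)
  show "\<And>i j. i < card \<alpha> \<Longrightarrow> j < card \<alpha> \<Longrightarrow>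
      principal_submatrix A \<alpha> $$ (i, j) = A $$ (pick \<alpha> i, pick \<alpha> j)"
    unfolding principal_submatrix_def by (rule submatrix_index) (simp_all add: carrier_matD[OF A] eq)
  have "inj_on (pick \<alpha>) {0..<card \<alpha>}"
  proof (rule linorder_inj_onI)
    fix x y assume "x < y" "x \<in> {0..<card \<alpha>}" "y \<in> {0..<card \<alpha>}"
    then show "pick \<alpha> x \<noteq> pick \<alpha> y" using pick_mono_le[of y \<alpha> x] by simp
  qed auto
  moreover have "pick \<alpha> ` {0..<card \<alpha>} \<subseteq> \<alpha>" using pick_in_set_le by auto
  ultimately show "bij_betw (pick \<alpha>) {0..<card \<alpha>} \<alpha>"
    using \<alpha> unfolding bij_betw_def
    by (intro conjI card_subset_eq) (auto simp: card_image intro: finite_subset)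
qed

lemma poly_char_poly_principal_submatrix:
  assumes A: "(A :: 'a :: field mat) \<in> carrier_mat n n" and \<alpha>: "\<alpha> \<subseteq> {0..<n}"
  shows "poly (char_poly (principal_submatrix A \<alpha>)) x
    = principal_minor (\<lambda>i j. (if i = j then x else 0) - A $$ (i, j)) \<alpha>"
proof -
  note sub = principal_submatrix_reindex[OF A \<alpha>]
  have "poly (char_poly (principal_submatrix A \<alpha>)) x = det (- char_matrix (principal_submatrix A \<alpha>) x)"
    by (rule char_poly_matrix[OF sub(1)])
  also have "\<dots> = principal_minor (\<lambda>i j. (- char_matrix (principal_submatrix A \<alpha>) x) $$ (i, j)) {0..<card \<alpha>}"
    unfolding principal_minor_def by (rule det_def') (use sub(1) in \<open>simp\<close>)
  also have "\<dots> = principal_minor (\<lambda>i j. (if pick \<alpha> i = pick \<alpha> j then x else 0) - A $$ (pick \<alpha> i, pick \<alpha> j)) {0..<card \<alpha>}"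
  proof (rule principal_minor_cong)
    fix i j assume "i \<in> {0..<card \<alpha>}" "j \<in> {0..<card \<alpha>}"
    moreover from this have "pick \<alpha> i = pick \<alpha> j \<longleftrightarrow> i = j"
      by (rule inj_on_eq_iff[OF bij_betw_imp_inj_on[OF sub(2)]])
    ultimately show "(- char_matrix (principal_submatrix A \<alpha>) x) $$ (i, j)
        = (if pick \<alpha> i = pick \<alpha> j then x else 0) - A $$ (pick \<alpha> i, pick \<alpha> j)"
      using sub(3)[of i j] by (simp add: char_matrix_def carrier_matD[OF sub(1)])
  qed
  also have "\<dots> = principal_minor (\<lambda>i j. (if i = j then x else 0) - A $$ (i, j)) \<alpha>"
    by (rule principal_minor_reindex[OF sub(2), symmetric]) simp
  finally show ?thesis .
qed

lemma spectrally_monomorphic_iff_principal_minor: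
  assumes "A \<in> carrier_mat n n"
  shows "spectrally_monomorphic k A \<longleftrightarrow>
    (\<forall>\<alpha> \<beta> x. \<alpha> \<subseteq> {0..<n} \<and> card \<alpha> = k \<and> \<beta> \<subseteq> {0..<n} \<and> card \<beta> = k \<longrightarrow>
      principal_minor (\<lambda>i j. (if i = j then x else 0) - A $$ (i, j)) \<alpha>
      = principal_minor (\<lambda>i j. (if i = j then x else 0) - A $$ (i, j)) \<beta>)"
proof -
  have poly_eq: "p = q \<longleftrightarrow> (\<forall>x. poly p x = poly q x)" for p q :: "complex poly"
    by (metis poly_eq_poly_eq_iff ext)
  have dim: "dim_row A = n" using assms by simp
  show ?thesis
    unfolding spectrally_monomorphic_def poly_eq dim
    by (simp add: poly_char_poly_principal_submatrix[OF assms] cong: imp_cong)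
qed

text \<open>
  The classical fact that the coefficients of a characteristic polynomial are, up to sign, the sums of
  the principal minors of each size. After multiplying out, the factors \<open>x\<close> sit on a set \<open>S - X\<close> which
  the permutation must fix pointwise, so it is a permutation of \<open>X\<close>.
\<close>

lemma principal_minor_shift_expand:
  assumes S: "finite S"
  shows "principal_minor (\<lambda>i j. (if i = j then x else 0) - f i j) S
    = (\<Sum>X\<in>Pow S. x ^ (card S - card X) * principal_minor (\<lambda>i j. - f i j) X)"
proof -
  let ?P = "\<lambda>X. {p. p permutes X}"
  have fin: "finite (?P X)" if "X \<subseteq> S" for X
    using S that by (intro finite_permutations) (rule finite_subset)
  have inner: "(\<Sum>p\<in>?P S. of_int (sign p) * ((\<Prod>i\<in>X. - f i (p i)) * (\<Prod>i\<in>S - X. if i = p i then x else 0)))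
      = x ^ (card S - card X) * principal_minor (\<lambda>i j. - f i j) X" if X: "X \<subseteq> S" for X
  proof -
    have "(\<Sum>p\<in>?P S. of_int (sign p) * ((\<Prod>i\<in>X. - f i (p i)) * (\<Prod>i\<in>S - X. if i = p i then x else 0)))
      = (\<Sum>p\<in>?P X. of_int (sign p) * ((\<Prod>i\<in>X. - f i (p i)) * (\<Prod>i\<in>S - X. if i = p i then x else 0)))"
    proof (rule sum.mono_neutral_right[OF fin[OF order_refl]])
      show "?P X \<subseteq> ?P S" using X permutes_subset by blast
      show "\<forall>p\<in>?P S - ?P X. of_int (sign p) * ((\<Prod>i\<in>X. - f i (p i)) * (\<Prod>i\<in>S - X. if i = p i then x else 0)) = 0"
      proof
        fix p assume p: "p \<in> ?P S - ?P X"
        then have "\<exists>i\<in>S - X. p i \<noteq> i"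
          using permutes_superset[of p S X] by auto
        then have "\<exists>i\<in>S - X. (if i = p i then x else 0) = 0" by force
        then have "(\<Prod>i\<in>S - X. if i = p i then x else 0) = 0"
          using S by (intro prod_zero) auto
        then show "of_int (sign p) * ((\<Prod>i\<in>X. - f i (p i)) * (\<Prod>i\<in>S - X. if i = p i then x else 0)) = 0"
          by simp
      qed
    qed
    also have "\<dots> = (\<Sum>p\<in>?P X. x ^ (card S - card X) * (of_int (sign p) * (\<Prod>i\<in>X. - f i (p i))))"
    proof (rule sum.cong[OF refl])
      fix p assume "p \<in> ?P X"
      then have "(\<Prod>i\<in>S - X. if i = p i then x else 0) = (\<Prod>i\<in>S - X. x)"
        by (intro prod.cong) (auto simp: permutes_not_in)
      then show "of_int (sign p) * ((\<Prod>i\<in>X. - f i (p i)) * (\<Prod>i\<in>S - X. if i = p i then x else 0))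
          = x ^ (card S - card X) * (of_int (sign p) * (\<Prod>i\<in>X. - f i (p i)))"
        using X S by (simp add: card_Diff_subset finite_subset)
    qed
    finally show ?thesis by (simp add: principal_minor_def sum_distrib_left)
  qed
  have "principal_minor (\<lambda>i j. (if i = j then x else 0) - f i j) S
      = (\<Sum>p\<in>?P S. of_int (sign p) * (\<Prod>i\<in>S. - f i (p i) + (if i = p i then x else 0)))"
    unfolding principal_minor_def by simp
  also have "\<dots> = (\<Sum>p\<in>?P S. \<Sum>X\<in>Pow S. of_int (sign p) *
      ((\<Prod>i\<in>X. - f i (p i)) * (\<Prod>i\<in>S - X. if i = p i then x else 0)))"
    by (simp only: prod_add[OF S] sum_distrib_left)
  also have "\<dots> = (\<Sum>X\<in>Pow S. \<Sum>p\<in>?P S. of_int (sign p) *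
      ((\<Prod>i\<in>X. - f i (p i)) * (\<Prod>i\<in>S - X. if i = p i then x else 0)))"
    by (rule sum.swap)
  also have "\<dots> = (\<Sum>X\<in>Pow S. x ^ (card S - card X) * principal_minor (\<lambda>i j. - f i j) X)"
    by (intro sum.cong refl inner) auto
  finally show ?thesis .
qed

section \<open>Functions determined by their sums over larger subsets\<close>

lemma constant_on_subsets_of_size_if_swap:
  fixes m :: "'a set \<Rightarrow> 'b"
  assumes fin: "finite V"
    and swap: "\<And>x y C. x \<in> V \<Longrightarrow> y \<in> V \<Longrightarrow> x \<noteq> y \<Longrightarrow> C \<subseteq> V - {x, y} \<Longrightarrow> card C = j \<Longrightarrow>
      m (insert x C) = m (insert y C)"
    and B: "B \<subseteq> V" "card B = Suc j" and B': "B' \<subseteq> V" "card B' = Suc j"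
  shows "m B = m B'"
  using B
proof (induction "card (B - B')" arbitrary: B)
  case 0
  have "finite B" "finite B'" using 0(2) B' fin by (auto intro: finite_subset)
  then have "B = B'" using 0 B' by (intro card_subset_eq) auto
  then show ?case by simp
next
  case (Suc d)
  have finB: "finite B" "finite B'" using Suc.prems(1) B' fin by (auto intro: finite_subset)
  obtain x where x: "x \<in> B" "x \<notin> B'"
    using Suc.hyps(2) by (metis Diff_iff card.empty all_not_in_conv nat.distinct(1))
  obtain y where y: "y \<in> B'" "y \<notin> B"
    using x finB Suc.prems B' by (metis card_subset_eq subsetI)
  define B1 where "B1 = insert y (B - {x})"
  have "B1 - B' = (B - B') - {x}" using x y by (auto simp: B1_def)
  then have d: "d = card (B1 - B')" using Suc.hyps(2) x finB by simp
  have "B1 \<subseteq> V" "card B1 = Suc j"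
    using Suc.prems B' x y finB by (auto simp: B1_def)
  from Suc.hyps(1)[OF d this] have "m B1 = m B'" .
  moreover have "m (insert x (B - {x})) = m (insert y (B - {x}))"
    by (rule swap) (use Suc.prems(1,2) B' x y finB in auto)
  ultimately show ?case using x by (simp add: B1_def insert_absorb)
qed

lemma sum_subsets_of_size_insert:
  assumes A: "finite A" and x: "x \<notin> A"
  shows "(\<Sum>B | B \<subseteq> insert x A \<and> card B = Suc j. m B)
    = (\<Sum>B | B \<subseteq> A \<and> card B = Suc j. m B) + (\<Sum>C | C \<subseteq> A \<and> card C = j. m (insert x C))"
proof -
  let ?C = "{C. C \<subseteq> A \<and> card C = j}" and ?B = "{B. B \<subseteq> A \<and> card B = Suc j}"
  have finC: "finite C" if "C \<subseteq> A" for C using A that finite_subset by auto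
  have inj: "inj_on (insert x) ?C" using x by (intro inj_onI) (auto simp: insert_eq_iff)
  have "{B. B \<subseteq> insert x A \<and> card B = Suc j} = ?B \<union> insert x ` ?C"
  proof (intro equalityI subsetI)
    fix B assume B: "B \<in> {B. B \<subseteq> insert x A \<and> card B = Suc j}"
    show "B \<in> ?B \<union> insert x ` ?C"
    proof (cases "x \<in> B")
      case True
      then have "B = insert x (B - {x})" "B - {x} \<in> ?C"
        using B A by (auto simp: card_Diff_singleton_if)
      then show ?thesis by blast
    qed (use B in auto)
  qed (use x finC in \<open>auto simp: card_insert_if\<close>)
  moreover have "?B \<inter> insert x ` ?C = {}" using x by auto
  moreover have "finite ?B" "finite ?C" using A by auto
  ultimately show ?thesis
    by (simp add: sum.union_disjoint sum.reindex[OF inj])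
qed

text \<open>
  For \<open>j \<le> k\<close>, the inclusion matrix of \<open>j\<close>-subsets versus \<open>k\<close>-subsets of a set with at least \<open>j + k\<close>
  elements has full rank; only the consequence for constant sums is stated. Comparing the sums over \<open>insert x A\<close> and
  \<open>insert y A\<close> shows that the difference \<open>m (insert x C) - m (insert y C)\<close>, as a function of the
  \<open>(j - 1)\<close>-set \<open>C\<close> avoiding \<open>x\<close> and \<open>y\<close>, has all its sums over \<open>(k - 1)\<close>-sets equal to zero. Both the
  ground set and \<open>j + k\<close> have dropped by two, so by induction the difference is constant, hence zero.
  Thus \<open>m\<close> is unchanged when one element is exchanged for another, which makes it constant.
\<close>

lemma subset_sums_determine:
  fixes m :: "'a set \<Rightarrow> 'b::field_char_0"
  assumes "finite V" "j \<le> k" "j + k \<le> card V"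
    and "\<And>A. A \<subseteq> V \<Longrightarrow> card A = k \<Longrightarrow> (\<Sum>B | B \<subseteq> A \<and> card B = j. m B) = c"
    and "B \<subseteq> V" "card B = j" "B' \<subseteq> V" "card B' = j"
  shows "m B = m B'"
  using assms
proof (induction j arbitrary: V k m c B B')
  case 0
  have "finite B" "finite B'" using 0(1,5,7) by (auto intro: finite_subset)
  then show ?case using 0(6,8) by simp
next
  case (Suc j)
  note fin = Suc.prems(1) and sums = Suc.prems(4)
  obtain k' where k: "k = Suc k'" using Suc.prems(2) by (cases k) auto
  have swap: "m (insert x C) = m (insert y C)"
    if x: "x \<in> V" and y: "y \<in> V" and xy: "x \<noteq> y" and C: "C \<subseteq> V - {x, y}" "card C = j" for x y C
  proof -
    define V' where "V' = V - {x, y}"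
    define m' where "m' D = m (insert x D) - m (insert y D)" for D
    have cardV': "card V' = card V - 2"
      using x y xy fin by (simp add: V'_def card_Diff_subset)
    have finV': "finite V'" using fin by (simp add: V'_def)
    have bounds: "j \<le> k'" "j + k' \<le> card V'"
      using Suc.prems(2,3) by (auto simp: k cardV')
    have sum0: "(\<Sum>D | D \<subseteq> A \<and> card D = j. m' D) = 0" if A: "A \<subseteq> V'" "card A = k'" for A
    proof -
      have finA: "finite A" using A finV' finite_subset by auto
      have nx: "x \<notin> A" and ny: "y \<notin> A" using A by (auto simp: V'_def)
      have sx: "(\<Sum>B | B \<subseteq> insert x A \<and> card B = Suc j. m B) = c"
        by (rule sums) (use A x nx finA k in \<open>auto simp: V'_def\<close>)
      have sy: "(\<Sum>B | B \<subseteq> insert y A \<and> card B = Suc j. m B) = c"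
        by (rule sums) (use A y ny finA k in \<open>auto simp: V'_def\<close>)
      have "(\<Sum>D | D \<subseteq> A \<and> card D = j. m (insert x D)) = (\<Sum>D | D \<subseteq> A \<and> card D = j. m (insert y D))"
        using trans[OF sx sy[symmetric]]
        unfolding sum_subsets_of_size_insert[OF finA nx] sum_subsets_of_size_insert[OF finA ny]
        by (rule add_left_imp_eq)
      then show ?thesis by (simp add: m'_def sum_subtractf)
    qed
    have const: "m' D = m' C" if "D \<subseteq> V'" "card D = j" for D
      by (rule Suc.IH[where V = V' and k = k' and m = m' and c = 0, OF finV' bounds sum0]) (use that C in \<open>auto simp: V'_def\<close>)
    obtain A where A: "A \<subseteq> V'" "card A = k'"
      using bounds(2) obtain_subset_with_card_n[of k' V'] by auto
    have finA: "finite A" using A finV' finite_subset by auto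
    have "0 = (\<Sum>D | D \<subseteq> A \<and> card D = j. m' D)" by (simp only: sum0[OF A])
    also have "\<dots> = (\<Sum>D | D \<subseteq> A \<and> card D = j. m' C)"
      by (rule sum.cong[OF refl const]) (use A in auto)
    also have "\<dots> = of_nat (k' choose j) * m' C"
      using n_subsets[OF finA, of j] A by simp
    finally have "m' C = 0" using bounds(1) by simp
    then show ?thesis by (simp add: m'_def)
  qed
  show ?case
    by (rule constant_on_subsets_of_size_if_swap[where m = m and j = j, OF fin swap Suc.prems(5-8)])
qed

text \<open>
  Equal characteristic polynomials make the sums of the \<open>j\<close>-minors over each \<open>k\<close>-set equal, and these
  sums determine the minors.
\<close>

lemma minors_constant_if_char_polys_constant:
  fixes f :: "'a \<Rightarrow> 'a \<Rightarrow> 'b::real_normed_field"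
  assumes V: "finite V" and j: "j \<le> k" "j + k \<le> card V"
    and char_polys: "\<And>\<alpha> \<beta> x. \<alpha> \<subseteq> V \<Longrightarrow> card \<alpha> = k \<Longrightarrow> \<beta> \<subseteq> V \<Longrightarrow> card \<beta> = k \<Longrightarrow>
      principal_minor (\<lambda>i j. (if i = j then x else 0) - f i j) \<alpha>
      = principal_minor (\<lambda>i j. (if i = j then x else 0) - f i j) \<beta>"
    and A: "A \<subseteq> V" "card A = j" and B: "B \<subseteq> V" "card B = j"
  shows "principal_minor f A = principal_minor f B"
proof -
  define m where "m X = principal_minor (\<lambda>i j. - f i j) X" for X
  define coef where "coef \<alpha> i = (\<Sum>X\<in>{X \<in> Pow \<alpha>. card \<alpha> - card X = i}. m X)" for \<alpha> i
  have expand: "principal_minor (\<lambda>i j. (if i = j then x else 0) - f i j) \<alpha> = (\<Sum>i\<le>k. coef \<alpha> i * x ^ i)"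
    if \<alpha>: "\<alpha> \<subseteq> V" "card \<alpha> = k" for \<alpha> x
  proof -
    have fin: "finite \<alpha>" using \<alpha> V finite_subset by blast
    have "(\<Sum>i\<le>k. coef \<alpha> i * x ^ i)
        = (\<Sum>i\<le>k. \<Sum>X\<in>{X \<in> Pow \<alpha>. card \<alpha> - card X = i}. x ^ (card \<alpha> - card X) * m X)"
      unfolding coef_def sum_distrib_right by (intro sum.cong refl) (auto simp: mult.commute)
    also have "\<dots> = (\<Sum>X\<in>Pow \<alpha>. x ^ (card \<alpha> - card X) * m X)"
      by (rule sum.group) (use fin \<alpha> in auto)
    also have "\<dots> = principal_minor (\<lambda>i j. (if i = j then x else 0) - f i j) \<alpha>"
      by (simp add: principal_minor_shift_expand[OF fin] m_def)
    finally show ?thesis ..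
  qed
  have subset_sums: "(\<Sum>X | X \<subseteq> \<alpha> \<and> card X = j. m X) = coef \<alpha> (k - j)"
    if \<alpha>: "\<alpha> \<subseteq> V" "card \<alpha> = k" for \<alpha>
  proof -
    have fin: "finite \<alpha>" using \<alpha> V finite_subset by blast
    have "{X. X \<subseteq> \<alpha> \<and> card X = j} = {X \<in> Pow \<alpha>. card \<alpha> - card X = k - j}"
    proof -
      have "card X = j \<longleftrightarrow> card \<alpha> - card X = k - j" if "X \<subseteq> \<alpha>" for X
        using card_mono[OF fin that] \<alpha>(2) j(1) by auto
      then show ?thesis by auto
    qed
    then show ?thesis by (simp add: coef_def)
  qed
  obtain \<alpha>0 where \<alpha>0: "\<alpha>0 \<subseteq> V" "card \<alpha>0 = k"
    using obtain_subset_with_card_n[of k V] j by auto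
  have "m A = m B"
  proof (rule subset_sums_determine[where V = V and k = k and c = "coef \<alpha>0 (k - j)"])
    fix \<alpha> assume \<alpha>: "\<alpha> \<subseteq> V" "card \<alpha> = k"
    have "\<forall>x. (\<Sum>i\<le>k. coef \<alpha> i * x ^ i) = (\<Sum>i\<le>k. coef \<alpha>0 i * x ^ i)"
      using char_polys[OF \<alpha> \<alpha>0] by (simp add: expand \<alpha> \<alpha>0)
    then have "coef \<alpha> (k - j) = coef \<alpha>0 (k - j)"
      using polyfun_eq_coeffs[of "coef \<alpha>" k "coef \<alpha>0"] by simp
    then show "(\<Sum>X | X \<subseteq> \<alpha> \<and> card X = j. m X) = coef \<alpha>0 (k - j)"
      by (simp add: subset_sums[OF \<alpha>])
  qed (rule V j A B)+
  moreover have "m X = (- 1) ^ card X * principal_minor f X" for X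
    using principal_minor_scale[of "\<lambda>_. - 1" "\<lambda>_. 1" f X] by (simp add: m_def)
  ultimately show ?thesis using A B by simp
qed

section \<open>Transitive tournaments\<close>

text \<open>
  Transitivity is only asked of distinct triples and both directions may hold between two elements,
  because the relation used later, equality of a matrix entry with a fixed number \<open>w\<close>, is symmetric when
  \<open>w\<close> is real.
\<close>

lemma finite_set_has_least_if_transitive:
  assumes "finite A" "A \<noteq> {}"
    and total: "\<And>x y. x \<in> A \<Longrightarrow> y \<in> A \<Longrightarrow> x \<noteq> y \<Longrightarrow> R x y \<or> R y x"
    and trans: "\<And>x y z. x \<in> A \<Longrightarrow> y \<in> A \<Longrightarrow> z \<in> A \<Longrightarrow> distinct [x, y, z] \<Longrightarrow> R x y \<Longrightarrow> R y z \<Longrightarrow> R x z"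
  shows "\<exists>m\<in>A. \<forall>y\<in>A. y \<noteq> m \<longrightarrow> R m y"
  using assms
proof (induction A rule: finite_ne_induct)
  case (singleton x)
  show ?case by simp
next
  case (insert a A)
  have "\<exists>m\<in>A. \<forall>y\<in>A. y \<noteq> m \<longrightarrow> R m y"
  proof (rule insert.IH)
    show "R x y \<or> R y x" if "x \<in> A" "y \<in> A" "x \<noteq> y" for x y
      using that by (intro insert.prems(1)) auto
    show "R x z" if "x \<in> A" "y \<in> A" "z \<in> A" "distinct [x, y, z]" "R x y" "R y z" for x y z
      using that by (intro insert.prems(2)[of x y z]) auto
  qed
  then obtain m where m: "m \<in> A" "\<forall>y\<in>A. y \<noteq> m \<longrightarrow> R m y" by blast
  have am: "a \<noteq> m" using m insert.hyps by auto
  show ?case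
  proof (cases "R m a")
    case True
    then show ?thesis using m by (intro bexI[of _ m]) auto
  next
    case False
    then have "R a m" using insert.prems(1)[of a m] m am by auto
    have "R a y" if "y \<in> A" for y
    proof (cases "y = m")
      case False
      then have "R m y" "distinct [a, m, y]" using m that am insert.hyps by auto
      then show ?thesis using insert.prems(2)[of a m y] \<open>R a m\<close> m(1) that by blast
    qed (use \<open>R a m\<close> in simp)
    then show ?thesis by (intro bexI[of _ a]) auto
  qed
qed

lemma transitive_tournament_sorted:
  assumes "finite A"
    and total: "\<And>x y. x \<in> A \<Longrightarrow> y \<in> A \<Longrightarrow> x \<noteq> y \<Longrightarrow> R x y \<or> R y x"
    and trans: "\<And>x y z. x \<in> A \<Longrightarrow> y \<in> A \<Longrightarrow> z \<in> A \<Longrightarrow> distinct [x, y, z] \<Longrightarrow> R x y \<Longrightarrow> R y z \<Longrightarrow> R x z"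
  shows "\<exists>xs. distinct xs \<and> set xs = A \<and> sorted_wrt R xs"
  using assms
proof (induction "card A" arbitrary: A)
  case 0
  then show ?case by (intro exI[of _ "[]"]) auto
next
  case (Suc d)
  have "A \<noteq> {}" using Suc.hyps(2) by auto
  have "\<exists>m\<in>A. \<forall>y\<in>A. y \<noteq> m \<longrightarrow> R m y"
    by (rule finite_set_has_least_if_transitive) (fact \<open>A \<noteq> {}\<close> Suc.prems)+
  then obtain m where m: "m \<in> A" "\<forall>y\<in>A. y \<noteq> m \<longrightarrow> R m y" by blast
  have "\<exists>xs. distinct xs \<and> set xs = A - {m} \<and> sorted_wrt R xs"
  proof (rule Suc.hyps(1))
    show "d = card (A - {m})" using Suc.hyps(2) m Suc.prems(1) by simp
    show "finite (A - {m})" using Suc.prems(1) by simp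
    show "R x y \<or> R y x" if "x \<in> A - {m}" "y \<in> A - {m}" "x \<noteq> y" for x y
      using that by (intro Suc.prems(2)) auto
    show "R x z" if "x \<in> A - {m}" "y \<in> A - {m}" "z \<in> A - {m}" "distinct [x, y, z]" "R x y" "R y z" for x y z
      using that by (intro Suc.prems(3)[of x y z]) auto
  qed
  then obtain xs where "distinct xs" "set xs = A - {m}" "sorted_wrt R xs" by blast
  then show ?case using m by (intro exI[of _ "m # xs"]) auto
qed

section \<open>Hermitian matrices with constant minors of order at most four\<close>

text \<open>
  The situation after all diagonal entries have been shifted to \<open>0\<close> and a diagonal unitary congruence
  has turned row \<open>0\<close> off the diagonal into the positive constant \<open>r\<close>. The remaining freedom is a single number, the entry
  at \<open>(1, 2)\<close>: every other off-diagonal entry outside row and column \<open>0\<close> turns out to equal it or its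
  conjugate. If it is not real, this makes the matrix a tournament on the indices \<open>1, ..., n - 1\<close>.
\<close>

locale normalized_constant_minors =
  fixes n :: nat and r :: real and t :: "nat \<Rightarrow> nat \<Rightarrow> complex"
  assumes n: "5 \<le> n" and r: "0 < r"
    and herm: "\<And>i j. i < n \<Longrightarrow> j < n \<Longrightarrow> t j i = cnj (t i j)"
    and diag: "\<And>i. i < n \<Longrightarrow> t i i = 0"
    and base: "\<And>j. 0 < j \<Longrightarrow> j < n \<Longrightarrow> t 0 j = of_real r"
    and modulus: "\<And>i j. i < n \<Longrightarrow> j < n \<Longrightarrow> i \<noteq> j \<Longrightarrow> cmod (t i j) = r"
    and minors: "\<And>\<alpha> \<beta>. \<alpha> \<subseteq> {0..<n} \<Longrightarrow> \<beta> \<subseteq> {0..<n} \<Longrightarrow> card \<alpha> = card \<beta> \<Longrightarrow> card \<alpha> \<le> 4 \<Longrightarrow>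
      principal_minor t \<alpha> = principal_minor t \<beta>"
begin

definition w :: complex where "w = t 1 2"

lemma base': "0 < j \<Longrightarrow> j < n \<Longrightarrow> t j 0 = of_real r"
  using herm[of 0 j] base[of j] by simp

lemma minor_3:
  assumes "0 < j" "j < n" "0 < k" "k < n" "j \<noteq> k"
  shows "principal_minor t {0, j, k} = of_real (2 * r\<^sup>2 * Re (t j k))"
proof -
  have "principal_minor t {0, j, k} = t 0 j * t j k * t k 0 + t 0 k * t k j * t j 0"
    using assms diag[of 0] diag[of j] diag[of k]
    by (subst principal_minor_3) (auto simp: algebra_simps)
  also have "\<dots> = of_real (r\<^sup>2) * (t j k + cnj (t j k))"
    using assms by (simp add: base base' herm[of j k] algebra_simps power2_eq_square)
  finally show ?thesis by (simp add: complex_add_cnj)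
qed

text \<open>
  The minors of order three on triples through \<open>0\<close> determine the real part of an entry of known modulus.
\<close>

lemma entry_cases:
  assumes "0 < j" "j < n" "0 < k" "k < n" "j \<noteq> k"
  shows "t j k = w \<or> t j k = cnj w"
proof -
  have "principal_minor t {0, j, k} = principal_minor t {0, 1, 2}"
    by (rule minors) (use assms n in auto)
  then have "of_real (2 * r\<^sup>2 * Re (t j k)) = (of_real (2 * r\<^sup>2 * Re (t 1 2)) :: complex)"
    using minor_3[of j k] minor_3[of 1 2] assms n by simp
  then have re: "Re (t j k) = Re w"
    using r unfolding of_real_eq_iff w_def by simp
  have "(cmod (t j k))\<^sup>2 = (cmod w)\<^sup>2"
    using modulus[of j k] modulus[of 1 2] assms n by (simp add: w_def)
  then have "(Im (t j k))\<^sup>2 = (Im w)\<^sup>2" by (simp add: cmod_power2 re)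
  then have "Im (t j k) = Im w \<or> Im (t j k) = - Im w" by (simp add: power2_eq_iff)
  then show ?thesis using re by (auto simp: complex_eq_iff)
qed

text \<open>
  With row \<open>0\<close> constant off the diagonal, the four-cycles through \<open>0\<close> reduce to the products of two cyclically
  consecutive edges of the triangle \<open>x, y, z\<close>. For a cyclic triangle of the tournament the sum of these
  products is \<open>3 w\<^sup>2\<close> up to conjugation, for a transitive one it is \<open>w\<^sup>2 + 2 \<bar>w\<bar>\<^sup>2\<close>.
\<close>

lemma minor_4:
  assumes "0 < x" "x < n" "0 < y" "y < n" "0 < z" "z < n" "distinct [x, y, z]"
  shows "principal_minor t {0, x, y, z}
    = of_real (3 * r ^ 4 - 2 * r\<^sup>2 * Re (t x y * t y z + t y z * t z x + t z x * t x y))"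
proof -
  define X where "X = t x y * t y z + t y z * t z x + t z x * t x y"
  have sq: "t i j * t j i = of_real (r\<^sup>2)" if "i < n" "j < n" "i \<noteq> j" for i j
    using modulus[OF that] herm[of i j] that by (simp add: complex_norm_square[symmetric])
  have "principal_minor t {0, x, y, z} =
     t 0 x * t x 0 * (t y z * t z y) + t 0 y * t y 0 * (t x z * t z x) + t 0 z * t z 0 * (t x y * t y x)
     - (t 0 x * t x y * t y z * t z 0 + t 0 z * t z y * t y x * t x 0)
     - (t 0 y * t y z * t z x * t x 0 + t 0 x * t x z * t z y * t y 0)
     - (t 0 z * t z x * t x y * t y 0 + t 0 y * t y x * t x z * t z 0)"
    by (rule principal_minor_4_zero_diagonal) (use assms diag in auto)
  also have "\<dots> = 3 * of_real (r\<^sup>2) * of_real (r\<^sup>2) - of_real (r\<^sup>2) * (X + cnj X)"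
    using assms
    by (simp add: sq base base' X_def) (simp add: herm[of x y] herm[of y z] herm[of z x] algebra_simps power2_eq_square)
  also have "\<dots> = of_real (3 * r ^ 4 - 2 * r\<^sup>2 * Re X)"
    by (simp add: complex_add_cnj power4_eq_xxxx power2_eq_square)
  finally show ?thesis by (simp only: X_def)
qed

lemma triple_sum_constant:
  assumes "0 < x" "x < n" "0 < y" "y < n" "0 < z" "z < n" "distinct [x, y, z]"
    and "0 < a" "a < n" "0 < b" "b < n" "0 < c" "c < n" "distinct [a, b, c]"
  shows "Re (t x y * t y z + t y z * t z x + t z x * t x y)
    = Re (t a b * t b c + t b c * t c a + t c a * t a b)"
proof -
  have "principal_minor t {0, x, y, z} = principal_minor t {0, a, b, c}"
    by (rule minors) (use assms in auto)
  then show ?thesis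
    unfolding minor_4[OF assms(1-7)] minor_4[OF assms(8-14)] of_real_eq_iff using r by simp
qed

text \<open>
  If \<open>w\<close> is not real then \<open>Re (w\<^sup>2) < \<bar>w\<bar>\<^sup>2\<close>, so the minors of order four tell cyclic from transitive
  triangles and all triangles are of the same kind. They cannot all be cyclic: among four vertices the
  first has two successors or two predecessors, and such a pair spans a transitive triangle with it.
\<close>

lemma transitive:
  assumes w: "Im w \<noteq> 0"
    and xyz: "0 < x" "x < n" "0 < y" "y < n" "0 < z" "z < n" "distinct [x, y, z]"
    and xy: "t x y = w" and yz: "t y z = w"
  shows "t x z = w"
proof (rule ccontr)
  assume "t x z \<noteq> w"
  then have "t x z = cnj w" using entry_cases[of x z] xyz by auto
  then have zx: "t z x = w" using herm[of x z] xyz by simp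
  \<comment> \<open>the triangle \<open>x, y, z\<close> is now cyclic, hence so is every triangle\<close>
  have Re_w: "Re (w * w) \<noteq> Re (w * cnj w)" using w by simp
  have no_transitive_triple: "\<not> (t a b = w \<and> t b c = w \<and> t a c = w)"
    if "0 < a" "a < n" "0 < b" "b < n" "0 < c" "c < n" "distinct [a, b, c]" for a b c
  proof
    assume abc: "t a b = w \<and> t b c = w \<and> t a c = w"
    then have "t c a = cnj w" using herm[of a c] that by simp
    then show False
      using triple_sum_constant[OF xyz that] abc Re_w by (simp add: xy yz zx)
  qed
  have total: "t a b = w \<or> t b a = w" if "0 < a" "a < n" "0 < b" "b < n" "a \<noteq> b" for a b
    using entry_cases[of a b] herm[of a b] that by auto
  have two_out: "\<not> (t 1 b = w \<and> t 1 c = w)" if "b \<in> {2, 3, 4}" "c \<in> {2, 3, 4}" "b \<noteq> c" for b c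
    using total[of b c] no_transitive_triple[of 1 b c] no_transitive_triple[of 1 c b] that n by auto
  have two_in: "\<not> (t b 1 = w \<and> t c 1 = w)" if "b \<in> {2, 3, 4}" "c \<in> {2, 3, 4}" "b \<noteq> c" for b c
    using total[of b c] no_transitive_triple[of b c 1] no_transitive_triple[of c b 1] that n by auto
  have "t 1 2 = w \<or> t 2 1 = w" "t 1 3 = w \<or> t 3 1 = w" "t 1 4 = w \<or> t 4 1 = w"
    using total[of 1 2] total[of 1 3] total[of 1 4] n by auto
  then show False
    using two_out[of 2 3] two_out[of 2 4] two_out[of 3 4] two_in[of 2 3] two_in[of 2 4] two_in[of 3 4] by auto
qed

text \<open>
  Rescaling index \<open>0\<close> makes the other entries of row \<open>0\<close> equal to \<open>w\<close> as well, so that \<open>0\<close> becomes the least element and the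
  order extends to all indices. Sorting them puts \<open>w\<close> everywhere above the diagonal.
\<close>

lemma exists_ordering:
  "\<exists>u q c. q permutes {0..<n} \<and> (\<forall>i. cmod (u i) = 1) \<and>
    (\<forall>i j. i < j \<and> j < n \<longrightarrow> u (q i) * cnj (u (q j)) * t (q i) (q j) = c)"
proof -
  define u where "u i = (if i = 0 then w / of_real r else 1)" for i :: nat
  define s where "s i j = u i * cnj (u j) * t i j" for i j
  have cmod_w: "cmod w = r" using modulus[of 1 2] n by (simp add: w_def)
  have u: "cmod (u i) = 1" for i using r by (simp add: u_def cmod_w norm_divide)
  have s0: "s 0 j = w" if "0 < j" "j < n" for j
    using that r by (simp add: s_def u_def base)
  have s0': "s j 0 = cnj w" if "0 < j" "j < n" for j
    using that r by (simp add: s_def u_def base')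
  have s: "s j k = t j k" if "0 < j" "0 < k" for j k
    using that by (simp add: s_def u_def)
  have s_cases: "s i j = w \<or> s i j = cnj w" if "i < n" "j < n" "i \<noteq> j" for i j
    using that s0[of j] s0'[of i] s[of i j] entry_cases[of i j] by (cases "i = 0"; cases "j = 0") auto
  have total: "s i j = w \<or> s j i = w" if "i < n" "j < n" "i \<noteq> j" for i j
  proof -
    have "s j i = cnj (s i j)" using herm[of i j] that by (simp add: s_def)
    then show ?thesis using s_cases[OF that] by auto
  qed
  have trans: "s x z = w"
    if xyz: "x < n" "y < n" "z < n" "distinct [x, y, z]" and xy: "s x y = w" and yz: "s y z = w" for x y z
  proof (cases "Im w = 0")
    case True
    then have "cnj w = w" by (simp add: complex_eq_iff)
    then show ?thesis using s_cases[of x z] xyz by auto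
  next
    case False
    then have ne: "cnj w \<noteq> w" by (simp add: complex_eq_iff)
    \<comment> \<open>for non-real \<open>w\<close> nothing precedes \<open>0\<close>, as column \<open>0\<close> is \<open>cnj w\<close>\<close>
    have y: "0 < y" using s0'[of x] xy xyz ne by (cases "y = 0") auto
    have z: "0 < z" using s0'[of y] yz xyz ne y by (cases "z = 0") auto
    show ?thesis
    proof (cases "x = 0")
      case True
      then show ?thesis using s0[OF z] xyz by simp
    next
      case x: False
      have "t x z = w"
        by (rule transitive[OF False, of x y z]) (use x y z xyz xy yz s in auto)
      then show ?thesis using s x z by simp
    qed
  qed
  have "\<exists>xs. distinct xs \<and> set xs = {0..<n} \<and> sorted_wrt (\<lambda>i j. s i j = w) xs"
    by (rule transitive_tournament_sorted) (use total trans in auto)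
  then obtain xs where xs: "distinct xs" "set xs = {0..<n}" "sorted_wrt (\<lambda>i j. s i j = w) xs"
    by blast
  have len: "length xs = n" using distinct_card[OF xs(1)] xs(2) by simp
  define q where "q i = (if i < n then xs ! i else i)" for i
  have "bij_betw ((!) xs) {0..<n} {0..<n}"
    by (rule bij_betw_nth) (simp_all add: xs(1,2) len atLeast0LessThan)
  moreover have "bij_betw q {0..<n} {0..<n} \<longleftrightarrow> bij_betw ((!) xs) {0..<n} {0..<n}"
    by (rule bij_betw_cong) (simp add: q_def)
  ultimately have "bij_betw q {0..<n} {0..<n}" by simp
  then have "q permutes {0..<n}" by (rule bij_imp_permutes) (simp add: q_def)
  moreover have "u (q i) * cnj (u (q j)) * t (q i) (q j) = w" if "i < j" "j < n" for i j
    using sorted_wrt_nth_less[OF xs(3), of i j] that len by (simp add: q_def s_def)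
  ultimately show ?thesis using u by (intro exI[of _ u] exI[of _ q] exI[of _ w]) simp
qed

end

text \<open>
  Order two makes all off-diagonal entries equal in modulus. Unless they vanish, multiplying row and
  column \<open>j\<close> by unimodular factors with phase taken from the entry at \<open>(0, j)\<close> gives the normalized
  situation.
\<close>

lemma constant_small_minors_normal_form:
  fixes g :: "nat \<Rightarrow> nat \<Rightarrow> complex"
  assumes n: "5 \<le> n"
    and herm: "\<And>i j. i < n \<Longrightarrow> j < n \<Longrightarrow> g j i = cnj (g i j)"
    and diag: "\<And>i. i < n \<Longrightarrow> g i i = 0"
    and minors: "\<And>\<alpha> \<beta>. \<alpha> \<subseteq> {0..<n} \<Longrightarrow> \<beta> \<subseteq> {0..<n} \<Longrightarrow> card \<alpha> = card \<beta> \<Longrightarrow> card \<alpha> \<le> 4 \<Longrightarrow>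
      principal_minor g \<alpha> = principal_minor g \<beta>"
  shows "\<exists>u q c. q permutes {0..<n} \<and> (\<forall>i. cmod (u i) = 1) \<and>
    (\<forall>i j. i < j \<and> j < n \<longrightarrow> u i * cnj (u j) * g (q i) (q j) = c)"
proof -
  define r where "r = cmod (g 0 1)"
  have modulus: "cmod (g i j) = r" if ij: "i < n" "j < n" "i \<noteq> j" for i j
  proof -
    have minor_2: "principal_minor g {i, j} = - of_real ((cmod (g i j))\<^sup>2)" if "i < n" "j < n" "i \<noteq> j" for i j
      using that diag herm[of i j] by (simp add: principal_minor_2 complex_norm_square del: of_real_power)
    have "principal_minor g {i, j} = principal_minor g {0, 1}"
      by (rule minors) (use ij n in auto)
    moreover have "principal_minor g {0, 1} = - of_real ((cmod (g 0 1))\<^sup>2)"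
      by (rule minor_2) (use n in auto)
    ultimately have "- complex_of_real ((cmod (g i j))\<^sup>2) = - of_real ((cmod (g 0 1))\<^sup>2)"
      using minor_2[OF ij] by simp
    then have "(cmod (g i j))\<^sup>2 = (cmod (g 0 1))\<^sup>2"
      by (simp only: neg_equal_iff_equal of_real_eq_iff)
    then show ?thesis by (simp add: r_def)
  qed
  show ?thesis
  proof (cases "r = 0")
    case True
    then have "g i j = 0" if "i < j" "j < n" for i j using modulus[of i j] that by simp
    then show ?thesis
      by (intro exI[of _ "\<lambda>_. 1"] exI[of _ id] exI[of _ 0]) (auto simp: permutes_id)
  next
    case False
    then have r: "0 < r" by (simp add: r_def)
    define v where "v j = (if 0 < j \<and> j < n then g 0 j / of_real r else 1)" for j
    define t where "t i j = v i * cnj (v j) * g i j" for i j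
    have v: "cmod (v i) = 1" for i
      using modulus[of 0 i] r by (auto simp: v_def norm_divide)
    interpret normalized_constant_minors n r t
    proof
      show "t 0 j = of_real r" if "0 < j" "j < n" for j
      proof -
        have "t 0 j = cnj (g 0 j) * g 0 j / of_real r" using that by (simp add: t_def v_def)
        also have "cnj (g 0 j) * g 0 j = of_real r * of_real r"
          using modulus[of 0 j] that complex_norm_square[of "g 0 j"] by (simp add: power2_eq_square mult.commute)
        finally show ?thesis using r by simp
      qed
      show "principal_minor t \<alpha> = principal_minor t \<beta>"
        if "\<alpha> \<subseteq> {0..<n}" "\<beta> \<subseteq> {0..<n}" "card \<alpha> = card \<beta>" "card \<alpha> \<le> 4" for \<alpha> \<beta>
      proof -
        have "principal_minor t S = principal_minor g S" for S
        proof -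
          have "prod v S * prod (\<lambda>j. cnj (v j)) S = (\<Prod>i\<in>S. v i * cnj (v i))"
            by (simp add: prod.distrib)
          also have "\<dots> = 1"
            by (rule prod.neutral) (simp add: complex_norm_square[symmetric] v)
          finally show ?thesis unfolding t_def principal_minor_scale by simp
        qed
        then show ?thesis using minors[OF that] by simp
      qed
      show "t j i = cnj (t i j)" if "i < n" "j < n" for i j
        using herm[OF that] by (simp add: t_def)
      show "cmod (t i j) = r" if "i < n" "j < n" "i \<noteq> j" for i j
        using modulus[OF that] by (simp add: t_def norm_mult v)
      show "t i i = 0" if "i < n" for i
        using diag[OF that] by (simp add: t_def)
    qed (rule n r)+
    from exists_ordering obtain u q c where q: "q permutes {0..<n}" and u: "\<forall>i. cmod (u i) = 1"
      and c: "\<forall>i j. i < j \<and> j < n \<longrightarrow> u (q i) * cnj (u (q j)) * t (q i) (q j) = c"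
      by (elim exE conjE)
    show ?thesis
    proof (intro exI conjI allI impI)
      show "q permutes {0..<n}" by (rule q)
      show "cmod (u (q i) * v (q i)) = 1" for i using u by (simp add: norm_mult v)
      show "u (q i) * v (q i) * cnj (u (q j) * v (q j)) * g (q i) (q j) = c" if "i < j \<and> j < n" for i j
        using c[rule_format, OF that] by (simp add: t_def ac_simps)
    qed
  qed
qed

section \<open>The group of unitary monomial matrices\<close>

definition monomial_mat :: "nat \<Rightarrow> (nat \<Rightarrow> complex) \<Rightarrow> (nat \<Rightarrow> nat) \<Rightarrow> complex mat" where
  "monomial_mat n u q = mat n n (\<lambda>(i, j). if j = q i then u i else 0)"

lemma monomial_mat_carrier [simp]: "monomial_mat n u q \<in> carrier_mat n n"
  by (simp add: monomial_mat_def)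

lemma monomial_mat_times_index:
  assumes q: "q permutes {0..<n}" and A: "A \<in> carrier_mat n n" and ij: "i < n" "j < n"
  shows "(monomial_mat n u q * A) $$ (i, j) = u i * A $$ (q i, j)"
proof -
  have qi: "q i < n" using permutes_in_image[OF q, of i] ij by simp
  have "(monomial_mat n u q * A) $$ (i, j) = (\<Sum>l\<in>{0..<n}. (if l = q i then u i else 0) * A $$ (l, j))"
    using A ij by (simp add: scalar_prod_def monomial_mat_def)
  also have "\<dots> = (\<Sum>l\<in>{0..<n}. if l = q i then u i * A $$ (l, j) else 0)"
    by (intro sum.cong) auto
  also have "\<dots> = u i * A $$ (q i, j)" using qi by simp
  finally show ?thesis .
qed

lemma mat_adjoint_index:
  assumes "(A :: complex mat) \<in> carrier_mat n n" "i < n" "j < n"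
  shows "mat_adjoint A $$ (i, j) = cnj (A $$ (j, i))"
proof -
  have "mat_adjoint A $$ (i, j) = map conjugate (cols A) ! i $ j"
    unfolding mat_adjoint_def by (rule mat_of_rows_index) (use assms in auto)
  also have "map conjugate (cols A) ! i = conjugate (col A i)" using assms by simp
  also have "conjugate (col A i) $ j = conjugate (A $$ (j, i))" using assms by simp
  finally show ?thesis by simp
qed

lemma mat_adjoint_carrier: "A \<in> carrier_mat n n \<Longrightarrow> mat_adjoint A \<in> carrier_mat n n"
  by (rule carrier_matI) (simp_all add: mat_adjoint_def)

lemma monomial_congruence_index:
  fixes u :: "nat \<Rightarrow> complex"
  assumes q: "q permutes {0..<n}" and A: "A \<in> carrier_mat n n" and ij: "i < n" "j < n"
  defines "S \<equiv> monomial_mat n u q"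
  shows "(S * A * mat_adjoint S) $$ (i, j) = u i * cnj (u j) * A $$ (q i, q j)"
proof -
  have S: "S \<in> carrier_mat n n" by (simp add: S_def)
  have qj: "q j < n" using permutes_in_image[OF q, of j] ij by simp
  have "(S * A * mat_adjoint S) $$ (i, j) = (\<Sum>l\<in>{0..<n}. (S * A) $$ (i, l) * mat_adjoint S $$ (l, j))"
  proof -
    have "S * A \<in> carrier_mat n n" using S A by simp
    moreover note mat_adjoint_carrier[OF S]
    ultimately show ?thesis using ij S A by (subst index_mult_mat(1)) (auto simp: scalar_prod_def)
  qed
  also have "\<dots> = (\<Sum>l\<in>{0..<n}. if l = q j then u i * A $$ (q i, l) * cnj (u j) else 0)"
  proof (rule sum.cong[OF refl])
    fix l assume "l \<in> {0..<n}"
    then show "(S * A) $$ (i, l) * mat_adjoint S $$ (l, j)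
        = (if l = q j then u i * A $$ (q i, l) * cnj (u j) else 0)"
      using monomial_mat_times_index[OF q A ij(1), of l u] mat_adjoint_index[OF S, of l j] ij
      by (simp add: S_def monomial_mat_def)
  qed
  also have "\<dots> = u i * cnj (u j) * A $$ (q i, q j)" using qj by simp
  finally show ?thesis .
qed

lemma monomial_mat_mult:
  assumes q: "q permutes {0..<n}"
  shows "monomial_mat n u q * monomial_mat n v p = monomial_mat n (\<lambda>i. u i * v (q i)) (p \<circ> q)"
proof (rule eq_matI)
  fix i j
  assume "i < dim_row (monomial_mat n (\<lambda>i. u i * v (q i)) (p \<circ> q))"
    "j < dim_col (monomial_mat n (\<lambda>i. u i * v (q i)) (p \<circ> q))"
  then have ij: "i < n" "j < n" by (simp_all add: monomial_mat_def)
  then have "q i < n" using permutes_in_image[OF q, of i] by simp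
  then show "(monomial_mat n u q * monomial_mat n v p) $$ (i, j)
      = monomial_mat n (\<lambda>i. u i * v (q i)) (p \<circ> q) $$ (i, j)"
    using ij by (simp add: monomial_mat_times_index[OF q monomial_mat_carrier ij])
      (simp add: monomial_mat_def)
qed (simp_all add: monomial_mat_def)

lemma monomial_mat_one:
  assumes "\<And>i. i < n \<Longrightarrow> u i = 1"
  shows "monomial_mat n u id = 1\<^sub>m n"
  by (rule eq_matI) (auto simp: monomial_mat_def assms)

lemma unitary_diagonal_mats_eq:
  "unitary_diagonal_mats n = {monomial_mat n u id | u. \<forall>i<n. cmod (u i) = 1}"
proof (intro equalityI subsetI)
  fix D assume D: "D \<in> unitary_diagonal_mats n"
  have "D = monomial_mat n (\<lambda>i. D $$ (i, i)) id"
    using D by (intro eq_matI) (auto simp: unitary_diagonal_mats_def diagonal_mat_def monomial_mat_def)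
  then show "D \<in> {monomial_mat n u id | u. \<forall>i<n. cmod (u i) = 1}"
    using D by (auto simp: unitary_diagonal_mats_def)
qed (auto simp: unitary_diagonal_mats_def diagonal_mat_def monomial_mat_def)

lemma permutation_mat_eq:
  assumes "p permutes {0..<n}"
  shows "permutation_mat n p = monomial_mat n (\<lambda>_. 1) (inv_into UNIV p)"
proof -
  have "i = p j \<longleftrightarrow> j = inv_into UNIV p i" for i j
    using permutes_inv_eq[OF assms, of i j] by auto
  then show ?thesis by (simp add: permutation_mat_def monomial_mat_def)
qed

text \<open>
  Monomial matrices with unimodular entries contain the generators and are closed under products and
  inverses; conversely each is a unitary diagonal matrix times a permutation matrix.
\<close>

lemma Gamma_group_eq:
  "Gamma_group n = {monomial_mat n u q | u q. q permutes {0..<n} \<and> (\<forall>i<n. cmod (u i) = 1)}"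
  (is "_ = ?M")
proof (intro equalityI subsetI)
  interpret group "GL n" by (rule group_GL)
  have GL_mult: "A \<otimes>\<^bsub>GL n\<^esub> B = A * B" and GL_one: "\<one>\<^bsub>GL n\<^esub> = 1\<^sub>m n" for A B
    by (simp_all add: GL_def units_of_mult units_of_one ring_mat_simps)
  have mult: "S * T \<in> ?M" if S: "S \<in> ?M" and T: "T \<in> ?M" for S T
  proof -
    from S obtain u q where S': "S = monomial_mat n u q" "q permutes {0..<n}" "\<forall>i<n. cmod (u i) = 1"
      by blast
    from T obtain v p where T': "T = monomial_mat n v p" "p permutes {0..<n}" "\<forall>i<n. cmod (v i) = 1"
      by blast
    have "S * T = monomial_mat n (\<lambda>i. u i * v (q i)) (p \<circ> q)"
      unfolding S'(1) T'(1) by (rule monomial_mat_mult[OF S'(2)])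
    moreover have "p \<circ> q permutes {0..<n}" by (rule permutes_compose[OF S'(2) T'(2)])
    moreover have "\<forall>i<n. cmod (u i * v (q i)) = 1"
      using S'(3) T'(3) permutes_in_image[OF S'(2)] by (simp add: norm_mult)
    ultimately show ?thesis by blast
  qed
  have gen: "unitary_diagonal_mats n \<union> permutation_mats n \<subseteq> ?M"
  proof -
    have "unitary_diagonal_mats n \<subseteq> ?M"
      unfolding unitary_diagonal_mats_eq using permutes_id[of "{0..<n}"] by blast
    moreover have "permutation_mats n \<subseteq> ?M"
    proof
      fix P assume "P \<in> permutation_mats n"
      then obtain p where p: "p permutes {0..<n}" and P: "P = permutation_mat n p"
        by (auto simp: permutation_mats_def)
      show "P \<in> ?M"
        unfolding P permutation_mat_eq[OF p] using permutes_inv[OF p] by force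
    qed
    ultimately show ?thesis by blast
  qed
  have inv: "inv\<^bsub>GL n\<^esub> S \<in> ?M" if S: "S \<in> carrier (GL n)" "S \<in> ?M" for S
  proof -
    from S(2) obtain u q where S': "S = monomial_mat n u q" and q: "q permutes {0..<n}"
      and u: "\<forall>i<n. cmod (u i) = 1" by blast
    define p where "p = inv_into UNIV q"
    define T where "T = monomial_mat n (\<lambda>i. cnj (u (p i))) p"
    have p: "p permutes {0..<n}" unfolding p_def by (rule permutes_inv[OF q])
    have pn: "p i < n" if "i < n" for i using permutes_in_image[OF p, of i] that by simp
    have uu: "u i * cnj (u i) = 1" if "i < n" for i
      using u that by (simp add: complex_norm_square[symmetric])
    have pq: "q \<circ> p = id" "p \<circ> q = id" unfolding p_def by (rule permutes_inv_o[OF q])+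
    have TS: "T * S = 1\<^sub>m n"
      unfolding T_def S' monomial_mat_mult[OF p] pq
      by (rule monomial_mat_one) (simp add: uu pn mult.commute[of "cnj _"])
    have ST: "S * T = 1\<^sub>m n"
      unfolding T_def S' monomial_mat_mult[OF q] pq
      by (rule monomial_mat_one) (simp add: uu pointfree_idE[OF pq(2)])
    have "T \<in> carrier (GL n)"
      by (rule carrier_GL_I[OF _ _ TS ST]) (simp_all add: T_def S')
    then have "inv\<^bsub>GL n\<^esub> S = T"
      using TS S(1) by (intro inv_equality) (simp_all add: GL_mult GL_one)
    moreover have "T \<in> ?M" using p u pn unfolding T_def by force
    ultimately show ?thesis by simp
  qed
  have gens_GL: "unitary_diagonal_mats n \<union> permutation_mats n \<subseteq> carrier (GL n)"
    using unitary_diagonal_mats_GL permutation_mats_GL by auto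
  show "S \<in> ?M" if "S \<in> Gamma_group n" for S
    using that unfolding Gamma_group_def
  proof (induction rule: generate.induct)
    case one
    have "1\<^sub>m n = monomial_mat n (\<lambda>_. 1) id" by (simp add: monomial_mat_one)
    then show ?case using permutes_id[of "{0..<n}"] unfolding GL_one by force
  next
    case (incl h)
    then show ?case using gen by blast
  next
    case (inv h)
    then show ?case using gen gens_GL \<open>\<And>S. S \<in> carrier (GL n) \<Longrightarrow> S \<in> ?M \<Longrightarrow> inv\<^bsub>GL n\<^esub> S \<in> ?M\<close> by blast
  next
    case (eng h1 h2)
    then show ?case unfolding GL_mult by (intro mult)
  qed
  show "S \<in> Gamma_group n" if "S \<in> ?M" for S
  proof -
    from that obtain u q where S: "S = monomial_mat n u q" and q: "q permutes {0..<n}"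
      and u: "\<forall>i<n. cmod (u i) = 1" by blast
    let ?D = "monomial_mat n u id" and ?P = "permutation_mat n (inv_into UNIV q)"
    have "?D * ?P = S"
      unfolding S permutation_mat_eq[OF permutes_inv[OF q]] permutes_inv_inv[OF q]
      by (simp add: monomial_mat_mult[OF permutes_id])
    moreover have "?D \<in> unitary_diagonal_mats n" unfolding unitary_diagonal_mats_eq using u by blast
    moreover have "?P \<in> permutation_mats n" unfolding permutation_mats_def using permutes_inv[OF q] by blast
    ultimately show ?thesis
      unfolding Gamma_group_def GL_mult[symmetric] by (metis UnI1 UnI2 generate.eng generate.incl)
  qed
qed

section \<open>Spectral monomorphy and equivalence\<close>

lemma Hn_carrier: "Hn n c \<in> carrier_mat n n"
  by (simp add: Hn_def)

lemma hermitian_mat_iff: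
  assumes "A \<in> carrier_mat n n"
  shows "hermitian_mat A \<longleftrightarrow> (\<forall>i<n. \<forall>j<n. A $$ (j, i) = cnj (A $$ (i, j)))"
proof
  assume "hermitian_mat A"
  then have "mat_adjoint A = A" by (simp add: hermitian_mat_def)
  then show "\<forall>i<n. \<forall>j<n. A $$ (j, i) = cnj (A $$ (i, j))"
    using mat_adjoint_index[OF assms] by metis
next
  assume herm: "\<forall>i<n. \<forall>j<n. A $$ (j, i) = cnj (A $$ (i, j))"
  have "mat_adjoint A = A"
  proof (rule eq_matI)
    fix i j assume "i < dim_row A" "j < dim_col A"
    then have "i < n" "j < n" using assms by auto
    then show "mat_adjoint A $$ (i, j) = A $$ (i, j)"
      unfolding mat_adjoint_index[OF assms \<open>i < n\<close> \<open>j < n\<close>] using herm by metis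
  qed (use assms mat_adjoint_carrier[OF assms] in auto)
  then show "hermitian_mat A" using assms by (simp add: hermitian_mat_def)
qed

lemma hermitian_Hn: "hermitian_mat (Hn n c)"
  unfolding hermitian_mat_iff[OF Hn_carrier] by (auto simp: Hn_def)

text \<open>
  The enumeration of \<open>\<alpha>\<close> is increasing, so the strict upper triangle is preserved.
\<close>

lemma principal_submatrix_Hn:
  assumes \<alpha>: "\<alpha> \<subseteq> {0..<n}"
  shows "principal_submatrix (Hn n c) \<alpha> = Hn (card \<alpha>) c"
proof (rule eq_matI)
  note sub = principal_submatrix_reindex[OF Hn_carrier[of n c] \<alpha>]
  fix i j assume "i < dim_row (Hn (card \<alpha>) c)" "j < dim_col (Hn (card \<alpha>) c)"
  then have ij: "i < card \<alpha>" "j < card \<alpha>" by (simp_all add: Hn_def)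
  have "pick \<alpha> i < n" "pick \<alpha> j < n" using pick_in_set_le[OF ij(1)] pick_in_set_le[OF ij(2)] \<alpha> by auto
  moreover have "pick \<alpha> i < pick \<alpha> j \<longleftrightarrow> i < j" "pick \<alpha> i = pick \<alpha> j \<longleftrightarrow> i = j"
    using pick_mono_le[OF ij(1), of j] pick_mono_le[OF ij(2), of i] by (cases i j rule: linorder_cases; simp)+
  ultimately show "principal_submatrix (Hn n c) \<alpha> $$ (i, j) = Hn (card \<alpha>) c $$ (i, j)"
    unfolding sub(3)[OF ij] using ij by (simp add: Hn_def)
qed (use principal_submatrix_reindex(1)[OF Hn_carrier[of n c] \<alpha>] in \<open>simp_all add: Hn_def\<close>)

lemma spectrally_monomorphic_Hn: "spectrally_monomorphic k (Hn n c)"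
proof -
  have "dim_row (Hn n c) = n" by (simp add: Hn_def)
  then show ?thesis by (simp add: spectrally_monomorphic_def principal_submatrix_Hn)
qed

text \<open>
  The matrix products are evaluated once and for all here; afterwards an equivalence is a relabelling of
  the indices, a unimodular rescaling and a real affine map.
\<close>

lemma Gamma_equivalent_iff:
  assumes H1: "H1 \<in> carrier_mat n n" "hermitian_mat H1" and H2: "H2 \<in> carrier_mat n n" "hermitian_mat H2"
  shows "Gamma_equivalent n H1 H2 \<longleftrightarrow> (\<exists>(a::real) (b::real) u q. a \<noteq> 0 \<and> q permutes {0..<n} \<and>
    (\<forall>i<n. cmod (u i) = 1) \<and> (\<forall>i<n. \<forall>j<n.
      H2 $$ (i, j) = of_real a * (u i * cnj (u j) * H1 $$ (q i, q j)) + (if i = j then of_real b else 0)))"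
proof -
  have eq: "H2 = complex_of_real a \<cdot>\<^sub>m (S * H1 * mat_adjoint S) + complex_of_real b \<cdot>\<^sub>m 1\<^sub>m n \<longleftrightarrow>
    (\<forall>i<n. \<forall>j<n. H2 $$ (i, j) = of_real a * (u i * cnj (u j) * H1 $$ (q i, q j)) + (if i = j then of_real b else 0))"
    (is "H2 = ?R \<longleftrightarrow> ?E")
    if S: "S = monomial_mat n u q" and q: "q permutes {0..<n}" for a b S u q
  proof -
    have "S \<in> carrier_mat n n" by (simp add: S)
    note carr = this mat_adjoint_carrier[OF this]
    have R: "?R \<in> carrier_mat n n" using carr H1(1) by simp
    have R_index: "?R $$ (i, j) = of_real a * (u i * cnj (u j) * H1 $$ (q i, q j)) + (if i = j then of_real b else 0)"
      if ij: "i < n" "j < n" for i j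
    proof -
      have "?R $$ (i, j) = of_real a * (S * H1 * mat_adjoint S) $$ (i, j) + (if i = j then of_real b else 0)"
        using carr H1(1) ij by (simp del: index_mult_mat(1))
      then show ?thesis unfolding S monomial_congruence_index[OF q H1(1) ij] .
    qed
    show ?thesis
    proof
      assume "H2 = ?R"
      then show ?E using R_index by metis
    next
      assume E: ?E
      show "H2 = ?R"
        by (rule eq_matI) (use E R_index R H2(1) in auto)
    qed
  qed
  show ?thesis
  proof
    assume "Gamma_equivalent n H1 H2"
    then obtain a b :: real and S where a: "a \<noteq> 0" and S: "S \<in> Gamma_group n"
      and R: "H2 = complex_of_real a \<cdot>\<^sub>m (S * H1 * mat_adjoint S) + complex_of_real b \<cdot>\<^sub>m 1\<^sub>m n"
      unfolding Gamma_equivalent_def by (elim exE conjE)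
    from S obtain u q where S': "S = monomial_mat n u q" and q: "q permutes {0..<n}"
      and u: "\<forall>i<n. cmod (u i) = 1"
      unfolding Gamma_group_eq by blast
    show "\<exists>(a::real) (b::real) u q. a \<noteq> 0 \<and> q permutes {0..<n} \<and>
      (\<forall>i<n. cmod (u i) = 1) \<and> (\<forall>i<n. \<forall>j<n.
        H2 $$ (i, j) = of_real a * (u i * cnj (u j) * H1 $$ (q i, q j)) + (if i = j then of_real b else 0))"
      by (intro exI conjI) (rule a q u R[unfolded eq[OF S' q]])+
  next
    assume "\<exists>(a::real) (b::real) u q. a \<noteq> 0 \<and> q permutes {0..<n} \<and>
      (\<forall>i<n. cmod (u i) = 1) \<and> (\<forall>i<n. \<forall>j<n.
        H2 $$ (i, j) = of_real a * (u i * cnj (u j) * H1 $$ (q i, q j)) + (if i = j then of_real b else 0))"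
    then obtain a b :: real and u q where a: "a \<noteq> 0" and q: "q permutes {0..<n}"
      and u: "\<forall>i<n. cmod (u i) = 1"
      and E: "\<forall>i<n. \<forall>j<n.
        H2 $$ (i, j) = of_real a * (u i * cnj (u j) * H1 $$ (q i, q j)) + (if i = j then of_real b else 0)"
      by (elim exE conjE)
    have "monomial_mat n u q \<in> Gamma_group n" unfolding Gamma_group_eq using q u by blast
    with a E[folded eq[OF refl q]] H1 H2 show "Gamma_equivalent n H1 H2"
      unfolding Gamma_equivalent_def by (intro exI conjI)
  qed
qed

text \<open>
  The relabelling carries \<open>k\<close>-sets to \<open>k\<close>-sets, the unimodular factors cancel in each principal minor,
  and the affine map of the matrix becomes an affine substitution for the variable of the
  characteristic polynomial, at the cost of a factor common to all \<open>k\<close>-sets.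
\<close>

lemma spectrally_monomorphic_if_Gamma_equivalent:
  assumes equiv: "Gamma_equivalent n H1 H2" and mono: "spectrally_monomorphic k H2"
  shows "spectrally_monomorphic k H1"
proof -
  have H1: "H1 \<in> carrier_mat n n" "hermitian_mat H1" and H2: "H2 \<in> carrier_mat n n" "hermitian_mat H2"
    using equiv by (auto simp: Gamma_equivalent_def)
  obtain a b :: real and u q where a: "a \<noteq> 0" and q: "q permutes {0..<n}"
    and u: "\<forall>i<n. cmod (u i) = 1"
    and entry: "\<forall>i<n. \<forall>j<n.
      H2 $$ (i, j) = of_real a * (u i * cnj (u j) * H1 $$ (q i, q j)) + (if i = j then of_real b else 0)"
    using equiv unfolding Gamma_equivalent_iff[OF H1 H2] by (elim exE conjE)
  let ?ch = "\<lambda>A x i j. (if i = j then x else 0) - A $$ (i, j)"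
  have uu: "cnj (u i) * u i = 1" if "i < n" for i
    using u that complex_norm_square[of "u i"] by (simp add: mult.commute)
  have transfer: "principal_minor (?ch H1 x) \<alpha>
      = (1 / of_real a) ^ card \<alpha> * principal_minor (?ch H2 (of_real a * x + of_real b)) (inv_into UNIV q ` \<alpha>)"
    if \<alpha>: "\<alpha> \<subseteq> {0..<n}" for \<alpha> x
  proof -
    define \<beta> where "\<beta> = inv_into UNIV q ` \<alpha>"
    have \<beta>: "\<beta> \<subseteq> {0..<n}"
      unfolding \<beta>_def using \<alpha> permutes_in_image[OF permutes_inv[OF q]] by blast
    have bij: "bij_betw q \<beta> \<alpha>"
      unfolding \<beta>_def bij_betw_def
      using permutes_inj[OF q] permutes_surj[OF q] by (auto simp: image_f_inv_f intro: inj_on_subset)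
    have fin: "finite \<beta>" using \<beta> finite_subset by blast
    have "principal_minor (?ch H1 x) \<alpha> = principal_minor (\<lambda>i j. ?ch H1 x (q i) (q j)) \<beta>"
      by (rule principal_minor_reindex[OF bij fin])
    also have "\<dots> = principal_minor (\<lambda>i j. (cnj (u i) / of_real a) * u j * ?ch H2 (of_real a * x + of_real b) i j) \<beta>"
    proof (rule principal_minor_cong)
      fix i j assume "i \<in> \<beta>" "j \<in> \<beta>"
      then have ij: "i < n" "j < n" using \<beta> by auto
      have "q i = q j \<longleftrightarrow> i = j" using permutes_inj[OF q] by (simp add: inj_eq)
      moreover have "(cnj (u i) / of_real a) * u j * (u i * cnj (u j)) = 1 / of_real a"
      proof -
        have "(cnj (u i) / of_real a) * u j * (u i * cnj (u j))
            = (cnj (u i) * u i) * (cnj (u j) * u j) / of_real a" by (simp add: ac_simps)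
        then show ?thesis by (simp only: uu ij mult_1)
      qed
      moreover have "(cnj (u i) / of_real a) * u i = 1 / of_real a" using uu[OF ij(1)] by simp
      ultimately show "?ch H1 x (q i) (q j)
          = (cnj (u i) / of_real a) * u j * ?ch H2 (of_real a * x + of_real b) i j"
        using a entry ij by (cases "i = j") (simp_all add: field_simps)
    qed
    also have "\<dots> = (\<Prod>i\<in>\<beta>. (cnj (u i) * u i) / of_real a) * principal_minor (?ch H2 (of_real a * x + of_real b)) \<beta>"
      unfolding principal_minor_scale by (simp add: prod.distrib prod_dividef)
    also have "(\<Prod>i\<in>\<beta>. (cnj (u i) * u i) / of_real a) = (\<Prod>i\<in>\<beta>. 1 / complex_of_real a)"
      by (intro prod.cong refl) (use \<beta> uu in auto)
    also have "\<dots> = (1 / of_real a) ^ card \<alpha>"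
      using bij_betw_same_card[OF bij] by simp
    finally show ?thesis by (simp only: \<beta>_def)
  qed
  have image: "inv_into UNIV q ` \<alpha> \<subseteq> {0..<n} \<and> card (inv_into UNIV q ` \<alpha>) = card \<alpha>" if "\<alpha> \<subseteq> {0..<n}" for \<alpha>
  proof -
    note qi = permutes_inv[OF q]
    have "inv_into UNIV q ` \<alpha> \<subseteq> {0..<n}" using that permutes_in_image[OF qi] by blast
    moreover have "card (inv_into UNIV q ` \<alpha>) = card \<alpha>"
      by (rule card_image) (rule inj_on_subset[OF permutes_inj[OF qi]], simp)
    ultimately show ?thesis by blast
  qed
  show ?thesis
    unfolding spectrally_monomorphic_iff_principal_minor[OF H1(1)]
  proof (intro allI impI, elim conjE)
    fix \<alpha> \<beta> x
    assume \<alpha>: "\<alpha> \<subseteq> {0..<n}" "card \<alpha> = k" and \<beta>: "\<beta> \<subseteq> {0..<n}" "card \<beta> = k"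
    have "principal_minor (?ch H2 (of_real a * x + of_real b)) (inv_into UNIV q ` \<alpha>)
        = principal_minor (?ch H2 (of_real a * x + of_real b)) (inv_into UNIV q ` \<beta>)"
      by (rule mono[unfolded spectrally_monomorphic_iff_principal_minor[OF H2(1)], rule_format])
         (simp add: image \<alpha> \<beta>)
    then show "principal_minor (?ch H1 x) \<alpha> = principal_minor (?ch H1 x) \<beta>"
      unfolding transfer[OF \<alpha>(1)] transfer[OF \<beta>(1)] \<alpha>(2) \<beta>(2) by simp
  qed
qed

text \<open>
  The bounds on \<open>k\<close> are what makes all minors of order \<open>j \<le> 4\<close> constant: such \<open>j\<close> satisfy \<open>j \<le> k\<close> and
  \<open>j + k \<le> n\<close>. Minors of order one make the diagonal constant, and subtracting it only translates the
  characteristic polynomials.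
\<close>

lemma Gamma_equivalent_Hn_if_spectrally_monomorphic:
  assumes H: "H \<in> carrier_mat n n" "hermitian_mat H"
    and k: "4 \<le> k" "k + 4 \<le> n" and mono: "spectrally_monomorphic k H"
  shows "\<exists>c. Gamma_equivalent n H (Hn n c)"
proof -
  have herm: "H $$ (j, i) = cnj (H $$ (i, j))" if "i < n" "j < n" for i j
    using H(2)[unfolded hermitian_mat_iff[OF H(1)], rule_format, OF that] .
  have char_polys: "principal_minor (\<lambda>i j. (if i = j then x else 0) - H $$ (i, j)) \<alpha>
      = principal_minor (\<lambda>i j. (if i = j then x else 0) - H $$ (i, j)) \<beta>"
    if "\<alpha> \<subseteq> {0..<n}" "card \<alpha> = k" "\<beta> \<subseteq> {0..<n}" "card \<beta> = k" for \<alpha> \<beta> x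
    by (rule mono[unfolded spectrally_monomorphic_iff_principal_minor[OF H(1)], rule_format])
       (simp add: that)
  define d where "d = H $$ (0, 0)"
  have diag: "H $$ (i, i) = d" if i: "i < n" for i
  proof -
    have "principal_minor (\<lambda>i j. H $$ (i, j)) {i} = principal_minor (\<lambda>i j. H $$ (i, j)) {0}"
      by (rule minors_constant_if_char_polys_constant[where V = "{0..<n}" and j = 1 and k = k])
         (rule char_polys | use i k in simp)+
    then show ?thesis by (simp add: principal_minor_1 d_def)
  qed
  have "cnj d = d" unfolding d_def by (rule herm[symmetric]) (use k in simp_all)
  then have d_real: "of_real (Re d) = d" by (simp add: complex_eq_iff)
  define g where "g i j = H $$ (i, j) - (if i = j then d else 0)" for i j
  have "\<exists>u q c. q permutes {0..<n} \<and> (\<forall>i. cmod (u i) = 1) \<and>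
    (\<forall>i j. i < j \<and> j < n \<longrightarrow> u i * cnj (u j) * g (q i) (q j) = c)"
  proof (rule constant_small_minors_normal_form)
    show "5 \<le> n" using k by simp
    show "g j i = cnj (g i j)" if "i < n" "j < n" for i j
      using herm[OF that] \<open>cnj d = d\<close> by (simp add: g_def)
    show "g i i = 0" if "i < n" for i using diag[OF that] by (simp add: g_def)
    have shift: "principal_minor (\<lambda>i j. (if i = j then x else 0) - g i j) \<alpha>
        = principal_minor (\<lambda>i j. (if i = j then x + d else 0) - H $$ (i, j)) \<alpha>" for x \<alpha>
      by (rule principal_minor_cong) (simp add: g_def)
    show "principal_minor g \<alpha> = principal_minor g \<beta>"
      if "\<alpha> \<subseteq> {0..<n}" "\<beta> \<subseteq> {0..<n}" "card \<alpha> = card \<beta>" "card \<alpha> \<le> 4" for \<alpha> \<beta>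
    proof (rule minors_constant_if_char_polys_constant[where V = "{0..<n}" and j = "card \<alpha>" and k = k])
      show "principal_minor (\<lambda>i j. (if i = j then x else 0) - g i j) \<gamma>
          = principal_minor (\<lambda>i j. (if i = j then x else 0) - g i j) \<delta>"
        if "\<gamma> \<subseteq> {0..<n}" "card \<gamma> = k" "\<delta> \<subseteq> {0..<n}" "card \<delta> = k" for \<gamma> \<delta> x
        unfolding shift by (rule char_polys[OF that])
    qed (use that k in simp_all)
  qed
  then obtain u q c where q: "q permutes {0..<n}" and u: "\<forall>i. cmod (u i) = 1"
    and c: "\<forall>i j. i < j \<and> j < n \<longrightarrow> u i * cnj (u j) * g (q i) (q j) = c"
    by (elim exE conjE)
  have qn: "q i < n" if "i < n" for i using permutes_in_image[OF q, of i] that by simp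
  have q_eq: "q i = q j \<longleftrightarrow> i = j" for i j using permutes_inj[OF q] by (simp add: inj_eq)
  have entry: "Hn n c $$ (i, j) = u i * cnj (u j) * H $$ (q i, q j) + (if i = j then of_real (- Re d) else 0)"
    if ij: "i < n" "j < n" for i j
  proof (cases i j rule: linorder_cases)
    case less
    then show ?thesis using c ij by (simp add: Hn_def g_def q_eq)
  next
    case equal
    have "u i * cnj (u i) = 1" using u by (simp add: complex_norm_square[symmetric])
    then show ?thesis using equal ij diag[OF qn[OF ij(2)]] by (simp add: Hn_def d_real)
  next
    case greater
    then have "u j * cnj (u i) * H $$ (q j, q i) = c" using c ij by (simp add: g_def q_eq)
    then have "cnj c = u i * cnj (u j) * H $$ (q i, q j)"
      using herm[OF qn[OF ij(2)] qn[OF ij(1)]] by auto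
    then show ?thesis using greater ij by (simp add: Hn_def)
  qed
  have "Gamma_equivalent n H (Hn n c)"
    unfolding Gamma_equivalent_iff[OF H Hn_carrier hermitian_Hn]
    by (rule exI[of _ 1], rule exI[of _ "- Re d"], rule exI[of _ u], rule exI[of _ q])
       (use q u entry in simp)
  then show ?thesis ..
qed

theorem corollary3p5:
  fixes n k :: nat and H :: "complex mat"
  assumes "H \<in> carrier_mat n n" and "hermitian_mat H"
    and "n \<ge> 8" and "4 \<le> k" and "k \<le> n - 4"
  shows "spectrally_monomorphic k H \<longleftrightarrow> (\<exists>c::complex. Gamma_equivalent n H (Hn n c))"
proof
  assume "spectrally_monomorphic k H"
  then show "\<exists>c. Gamma_equivalent n H (Hn n c)"
    using Gamma_equivalent_Hn_if_spectrally_monomorphic[of H n k] assms by simp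
next
  assume "\<exists>c. Gamma_equivalent n H (Hn n c)"
  then show "spectrally_monomorphic k H"
    using spectrally_monomorphic_if_Gamma_equivalent spectrally_monomorphic_Hn by blast
qed

end
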